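(* Let $G=(V,E,m_1,m_2)$ be a finite connected undirected graph with vertex measure $m_1:V\to(0,\infty)$ and symmetric edge measure $m_2:E\to(0,\infty)$, and let $\omega_0:E\to(0,\infty)$ be any positive initial value. Then the weighted Lin-Lu-Yau curvature flow (with edge deletion, as specified in the context) $$\frac{d}{dt}\omega(t,e)=-\kappa_\omega(t,e)\,\omega(t,e),\qquad \omega(0,e)=\omega_0(e),$$ has a unique positive solution for all $t\in(0,\infty)$ and every edge $e\in E$ (each edge being considered as long as it has not been deleted).
   Context: Graphs are simple (no loops or multiple edges). Write $x\sim y$ if $(x,y)\in E$. **Distance.** For a weight $\omega:E\to(0,\infty)$, $d_\omega(u,v)=\inf\{\sum_{k=1}^n\omega(v_{k-1},v_k): u=v_0\sim v_1\sim\cdots\sim v_n=v\}$. **Kernels.** Let $\operatorname{Deg}(x)=\frac{1}{m_1(x)}\sum_{y\sim x}m_2(x,y)$. For small $\epsilon>0$ let $m_x^\epsilon$ be the probability measure on $V$ with $m_x^\epsilon(x)=1-\epsilon\operatorname{Deg}(x)$, $m_x^\epsilon(y)=\epsilon\, m_2(x,y)/m_1(x)$ for $y\sim x$, and $m_x^\epsilon(y)=0$ otherwise. These kernels depend only on $m_1,m_2$ and not on $\omega$. **Weighted Lin-Lu-Yau curvature.** For $x\ne y$, $$\kappa_\omega(x,y)=\lim_{\epsilon\to0^+}\frac1\epsilon\Big(1-\frac{W(m_x^\epsilon,m_y^\epsilon)}{d_\omega(x,y)}\Big),$$ where $W(m_x^\epsilon,m_y^\epsilon)=\inf_A\sum_{u,v\in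 V}d_\omega(u,v)A(u,v)$ is the Wasserstein distance with respect to $d_\omega$, the infimum being over all couplings $A$ of $m_x^\epsilon$ and $m_y^\epsilon$. For $e=(x,y)\in E$ put $\kappa_\omega(e)=\kappa_\omega(x,y)$, and write $\kappa_\omega(t,e)$ for the curvature computed with the weight $\omega(t,\cdot)$. **Edge deletion (surgery).** The weight is required to remain non-degenerate, i.e. every present edge is the unique shortest path between its endpoints; edges violating this are removed. Precisely, for $E'\subset E$ and $\omega:E'\to(0,\infty)$ let $D(E',\omega)$ be the set of $e=(x,y)\in E'$ for which there is a path from $x$ to $y$ in $(V,E')$, other than the single edge $e$, of total $\omega$-length at most $\omega(e)$. A positive solution for all time consists of finitely many times $0=T_0<T_1<\dots<T_k<T_{k+1}=\infty$ ($k\ge0$), edge sets $E\supset E_0\supset E_1\supset\dots\supset E_k$, and functions $\omega(\cdot,e)$, $e\in E_i$, on $[T_i,T_{i+1})$, such that: - $E_0=E\setminus D(E,\omega_0)$ and $\omega(0,e)=\omega_0(e)$ for $e\in E_0$; - on $[T_i,T_{i+1})$ the function $\omega(\cdot,e)$ is positive and continuously differentiable (one-sided at $T_i$), satisfies the flow equation for every $e\in E_i$, with $\kappa_\omega$ computed in the graph $(V,E_i,m_1,m_2|_{E_i})$, and $D(E_i,\omega(t,\cdot))=\emptyset$ for all $t$ in this interval; - for $i<k$ the limits $\omega(T_{i+1}^-,e)$, $e\in E_i$, exist and lie in $(0,\infty)$, the set $D(E_i,\omega(T_{i+1}^-,\cdot))$ is nonempty, $E_{i+1}=E_i\setminus D(E_i,\omega(T_{i+1}^-,\cdot))$,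 and $\omega(T_{i+1},e)=\omega(T_{i+1}^-,e)$ for $e\in E_{i+1}$. *)

theory Defs
  imports "HOL-Analysis.Analysis"
begin

text \<open>
  Edges are two-element vertex sets, so that edge functions such as \<open>m2\<close> and the weights \<open>\<omega>\<close> are
  symmetric by construction. Passing to a smaller edge set \<open>E'\<close> restricts them implicitly:
  every definition below only evaluates them on the edges of the given graph.
\<close>

definition simple_graph :: "'a set \<Rightarrow> 'a set set \<Rightarrow> bool" where
  "simple_graph V E \<longleftrightarrow> (\<forall>e\<in>E. e \<subseteq> V \<and> card e = 2)"

text \<open>A path \<open>u = v\<^sub>0 \<sim> \<dots> \<sim> v\<^sub>n = v\<close> is the list \<open>[v\<^sub>0, \<dots>, v\<^sub>n]\<close>; \<open>n = 0\<close> is allowed and vertices may repeat.\<close>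

definition path_between :: "'a set set \<Rightarrow> 'a \<Rightarrow> 'a \<Rightarrow> 'a list \<Rightarrow> bool" where
  "path_between E u v p \<longleftrightarrow>
     p \<noteq> [] \<and> hd p = u \<and> last p = v \<and> successively (\<lambda>x y. {x, y} \<in> E) p"

definition path_weight :: "('a set \<Rightarrow> real) \<Rightarrow> 'a list \<Rightarrow> real" where
  "path_weight \<omega> p = (\<Sum>k<length p - 1. \<omega> {p ! k, p ! Suc k})"

definition connected_graph :: "'a set \<Rightarrow> 'a set set \<Rightarrow> bool" where
  "connected_graph V E \<longleftrightarrow> (\<forall>u\<in>V. \<forall>v\<in>V. \<exists>p. path_between E u v p)"

definition wdist :: "'a set set \<Rightarrow> ('a set \<Rightarrow> real) \<Rightarrow> 'a \<Rightarrow> 'a \<Rightarrow> real" where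
  "wdist E \<omega> u v = Inf {path_weight \<omega> p | p. path_between E u v p}"

definition Deg :: "'a set set \<Rightarrow> ('a \<Rightarrow> real) \<Rightarrow> ('a set \<Rightarrow> real) \<Rightarrow> 'a \<Rightarrow> real" where
  "Deg E m1 m2 x = (\<Sum>y | {x, y} \<in> E. m2 {x, y}) / m1 x"

text \<open>A probability measure only for small \<open>\<epsilon>\<close>, which is all that matters for the limit in \<open>curvature\<close>.\<close>

definition kernel ::
    "'a set set \<Rightarrow> ('a \<Rightarrow> real) \<Rightarrow> ('a set \<Rightarrow> real) \<Rightarrow> real \<Rightarrow> 'a \<Rightarrow> 'a \<Rightarrow> real" where
  "kernel E m1 m2 \<epsilon> x y =
     (if y = x then 1 - \<epsilon> * Deg E m1 m2 x
      else if {x, y} \<in> E then \<epsilon> * m2 {x, y} / m1 x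
      else 0)"

definition coupling ::
    "'a set \<Rightarrow> ('a \<Rightarrow> real) \<Rightarrow> ('a \<Rightarrow> real) \<Rightarrow> ('a \<Rightarrow> 'a \<Rightarrow> real) \<Rightarrow> bool" where
  "coupling V \<mu> \<nu> A \<longleftrightarrow>
     (\<forall>u\<in>V. \<forall>v\<in>V. 0 \<le> A u v) \<and>
     (\<forall>u\<in>V. (\<Sum>v\<in>V. A u v) = \<mu> u) \<and>
     (\<forall>v\<in>V. (\<Sum>u\<in>V. A u v) = \<nu> v)"

definition wasserstein ::
    "'a set \<Rightarrow> ('a \<Rightarrow> 'a \<Rightarrow> real) \<Rightarrow> ('a \<Rightarrow> real) \<Rightarrow> ('a \<Rightarrow> real) \<Rightarrow> real" where
  "wasserstein V d \<mu> \<nu> = Inf {\<Sum>u\<in>V. \<Sum>v\<in>V. d u v * A u v | A. coupling V \<mu> \<nu> A}"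

definition curvature ::
    "'a set \<Rightarrow> 'a set set \<Rightarrow> ('a \<Rightarrow> real) \<Rightarrow> ('a set \<Rightarrow> real) \<Rightarrow> ('a set \<Rightarrow> real) \<Rightarrow> 'a \<Rightarrow> 'a \<Rightarrow> real" where
  "curvature V E m1 m2 \<omega> x y =
     Lim (at_right 0) (\<lambda>\<epsilon>. 1 / \<epsilon> *
       (1 - wasserstein V (wdist E \<omega>) (kernel E m1 m2 \<epsilon> x) (kernel E m1 m2 \<epsilon> y) / wdist E \<omega> x y))"

definition degenerate_edges :: "'a set set \<Rightarrow> ('a set \<Rightarrow> real) \<Rightarrow> 'a set set" where
  "degenerate_edges E \<omega> =
     {e \<in> E. \<exists>x y p. e = {x, y} \<and> path_between E x y p \<and> p \<noteq> [x, y] \<and> path_weight \<omega> p \<le> \<omega> e}"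

text \<open>The \<open>i\<close>-th time interval \<open>[T\<^sub>i, T\<^sub>i\<^sub>+\<^sub>1)\<close>, where \<open>T\<^sub>k\<^sub>+\<^sub>1 = \<infinity>\<close>; only \<open>T 0, \<dots>, T k\<close> are relevant.\<close>

definition phase :: "nat \<Rightarrow> (nat \<Rightarrow> real) \<Rightarrow> nat \<Rightarrow> real set" where
  "phase k T i = (if i < k then {T i..<T (Suc i)} else {T i..})"

text \<open>
  The equation is required for both orientations \<open>(x, y)\<close> of an edge, which makes sense because the
  curvature is symmetric in \<open>x\<close> and \<open>y\<close>. On \<open>[T\<^sub>i, T\<^sub>i\<^sub>+\<^sub>1)\<close> the derivative within the interval is
  the ordinary derivative in the interior and the one-sided derivative at \<open>T\<^sub>i\<close>.
\<close>

definition solves_flow_on ::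
    "'a set \<Rightarrow> 'a set set \<Rightarrow> ('a \<Rightarrow> real) \<Rightarrow> ('a set \<Rightarrow> real) \<Rightarrow> real set \<Rightarrow>
     (real \<Rightarrow> 'a set \<Rightarrow> real) \<Rightarrow> bool" where
  "solves_flow_on V E m1 m2 I \<omega> \<longleftrightarrow>
     (\<forall>e\<in>E. (\<forall>t\<in>I. 0 < \<omega> t e) \<and>
       (\<exists>\<omega>'. continuous_on I \<omega>' \<and>
         (\<forall>t\<in>I. ((\<lambda>s. \<omega> s e) has_real_derivative \<omega>' t) (at t within I) \<and>
           (\<forall>x y. e = {x, y} \<longrightarrow> \<omega>' t = - curvature V E m1 m2 (\<omega> t) x y * \<omega> t e))))"

text \<open>
  Since the phases partition \<open>[0, \<infinity>)\<close>, a single function \<open>\<omega>\<close> describes the weights in all phases.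
  Its values \<open>\<omega> t e\<close> at negative times and for edges \<open>e\<close> not present at time \<open>t\<close> are irrelevant,
  as are \<open>T i\<close> and \<open>Es i\<close> for \<open>i > k\<close>. The function \<open>\<omega>L\<close> is the left limit of \<open>\<omega>\<close> at the next
  surgery time.
\<close>

definition flow_solution ::
    "'a set \<Rightarrow> 'a set set \<Rightarrow> ('a \<Rightarrow> real) \<Rightarrow> ('a set \<Rightarrow> real) \<Rightarrow> ('a set \<Rightarrow> real) \<Rightarrow>
     nat \<Rightarrow> (nat \<Rightarrow> real) \<Rightarrow> (nat \<Rightarrow> 'a set set) \<Rightarrow> (real \<Rightarrow> 'a set \<Rightarrow> real) \<Rightarrow> bool" where
  "flow_solution V E m1 m2 \<omega>0 k T Es \<omega> \<longleftrightarrow>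
     T 0 = 0 \<and> (\<forall>i<k. T i < T (Suc i)) \<and>
     Es 0 = E - degenerate_edges E \<omega>0 \<and> (\<forall>e\<in>Es 0. \<omega> 0 e = \<omega>0 e) \<and>
     (\<forall>i\<le>k. solves_flow_on V (Es i) m1 m2 (phase k T i) \<omega> \<and>
       (\<forall>t\<in>phase k T i. degenerate_edges (Es i) (\<omega> t) = {})) \<and>
     (\<forall>i<k. \<exists>\<omega>L.
       (\<forall>e\<in>Es i. 0 < \<omega>L e \<and> ((\<lambda>t. \<omega> t e) \<longlongrightarrow> \<omega>L e) (at_left (T (Suc i)))) \<and>
       degenerate_edges (Es i) \<omega>L \<noteq> {} \<and>
       Es (Suc i) = Es i - degenerate_edges (Es i) \<omega>L \<and>
       (\<forall>e\<in>Es (Suc i). \<omega> (T (Suc i)) e = \<omega>L e))"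

text \<open>Equality of two solutions as families of functions on the times and edges where they live.\<close>

definition same_solution ::
    "nat \<Rightarrow> (nat \<Rightarrow> real) \<Rightarrow> (nat \<Rightarrow> 'a set set) \<Rightarrow> (real \<Rightarrow> 'a set \<Rightarrow> real) \<Rightarrow>
     nat \<Rightarrow> (nat \<Rightarrow> real) \<Rightarrow> (nat \<Rightarrow> 'a set set) \<Rightarrow> (real \<Rightarrow> 'a set \<Rightarrow> real) \<Rightarrow> bool" where
  "same_solution k T Es \<omega> k' T' Es' \<omega>' \<longleftrightarrow>
     k = k' \<and>
     (\<forall>i\<le>k. T i = T' i \<and> Es i = Es' i \<and> (\<forall>t\<in>phase k T i. \<forall>e\<in>Es i. \<omega> t e = \<omega>' t e))"

end

theory Submission
  imports Defs "HOL-Probability.Discrete_Topology"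
begin

text \<open>
  For small \<open>\<epsilon>\<close> the couplings of \<open>m\<^sub>x\<^sup>\<epsilon>\<close> and \<open>m\<^sub>y\<^sup>\<epsilon>\<close> are the matrices \<open>\<delta>\<^sub>(\<^sub>x\<^sub>,\<^sub>y\<^sub>) + \<epsilon> B\<close>, where \<open>B\<close> ranges over
  a compact polytope independent of \<open>\<epsilon>\<close> and \<open>\<omega>\<close>. Hence \<open>W(m\<^sub>x\<^sup>\<epsilon>, m\<^sub>y\<^sup>\<epsilon>) = d(x, y) + \<epsilon> G(d)\<close> exactly, with
  \<open>G(d) = inf\<^sub>B \<Sum> d(u, v) B(u, v)\<close>, and \<open>-\<kappa>(x, y) d(x, y) = G(d)\<close>. As an infimum of linear functionals
  with bounded coefficients, \<open>G\<close> is Lipschitz in \<open>d\<close>, and \<open>d\<close> is Lipschitz in \<open>\<omega>\<close>; reading \<open>d\<close> off \<open>\<bar>\<omega>\<bar>\<close>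
  turns the flow into an ODE with a globally Lipschitz field, so its solutions are global and unique.
  They stay positive because \<open>B(x, y) \<ge> -(Deg x + Deg y)\<close> while all other entries are nonnegative, which gives
  \<open>G(d) \<ge> -(Deg x + Deg y) d(x, y)\<close>. The solution of this ODE is the flow until the first time an edge becomes
  degenerate; that time exists since degeneracy is a closed condition, and surgery then
  decreases the number of edges.
\<close>

section \<open>Ordinary differential equations with Lipschitz fields\<close>

lemma integral_has_vector_derivative_atLeast:
  fixes h :: "real \<Rightarrow> 'b::banach"
  assumes "continuous_on {0..} h" "0 \<le> t"
  shows "((\<lambda>u. integral {0..u} h) has_vector_derivative h t) (at t within {0..})"
proof -
  have "((\<lambda>u. integral {0..u} h) has_vector_derivative h t) (at t within {0..t+1})"
    using assms by (intro integral_has_vector_derivative) (auto intro: continuous_on_subset)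
  moreover have "at t within {0..t+1} = at t within {0..}"
    using assms(2) by (intro at_within_nhd[of t "{..<t+1}"]) auto
  ultimately show ?thesis by simp
qed

lemma has_integral_exp_mult:
  fixes K :: real
  assumes "0 < K" "0 \<le> t"
  shows "((\<lambda>s. exp (K * s)) has_integral (exp (K * t) - 1) / K) {0..t}"
proof -
  have "((\<lambda>s. exp (K * s)) has_integral (exp (K * t) / K - exp (K * 0) / K)) {0..t}"
    using assms
    by (intro fundamental_theorem_of_calculus)
       (auto intro!: derivative_eq_intros simp: has_real_derivative_iff_has_vector_derivative[symmetric])
  then show ?thesis by (simp add: diff_divide_distrib)
qed

text \<open>The Picard operator is a contraction for the weighted norm \<open>sup\<^sub>t e\<^sup>-\<^sup>K\<^sup>t \<parallel>x t\<parallel>\<close> with \<open>K = L + 1\<close>;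
  below, \<open>y\<close> stands for \<open>e\<^sup>-\<^sup>K\<^sup>t x\<close>.\<close>

theorem lipschitz_field_global_solution:
  fixes F :: "'b::banach \<Rightarrow> 'b"
  assumes L: "0 \<le> L" and lip: "\<And>x y. norm (F x - F y) \<le> L * norm (x - y)"
  obtains x where "x 0 = x0"
    and "\<And>t. 0 \<le> t \<Longrightarrow> (x has_vector_derivative F (x t)) (at t within {0..})"
proof -
  define K where "K = L + 1"
  have K: "0 < K" using L by (simp add: K_def)
  define h where "h y s = F (exp (K * s) *\<^sub>R apply_bcontfun y s)" for y :: "real \<Rightarrow>\<^sub>C 'b" and s
  have "continuous_on UNIV F"
    using L lip by (intro lipschitz_on_continuous_on[of L] lipschitz_onI) (auto simp: dist_norm)
  then have F: "continuous_on S f \<Longrightarrow> continuous_on S (\<lambda>s. F (f s))" for f :: "real \<Rightarrow> 'b" and S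
    using continuous_on_compose2[of UNIV F S f] by auto
  have h: "continuous_on S (h y)" for y S
    unfolding h_def by (intro F continuous_intros) auto
  define I where "I y u = x0 + integral {0..u} (h y)" for y u
  have I: "((I y) has_vector_derivative h y t) (at t within {0..})" if "0 \<le> t" for y t
    unfolding I_def using that
    by (auto intro!: derivative_eq_intros integral_has_vector_derivative_atLeast h)
  have Ic: "continuous_on {0..} (I y)" for y
    using I by (auto intro!: has_vector_derivative_continuous simp: continuous_on_eq_continuous_within)
  \<comment> \<open>The space of bounded continuous functions used here lives on the whole real
    line; \<open>max 0 t\<close> continues the weighted Picard iterate to negative times as a
    constant.\<close>
  define \<Phi> where "\<Phi> y t = exp (- K * max 0 t) *\<^sub>R I y (max 0 t)" for y t
  have \<Phi>c: "continuous_on UNIV (\<Phi> y)" for y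
    unfolding \<Phi>_def by (intro continuous_intros continuous_on_compose2[OF Ic, of _ "max 0"]) (auto simp: max_def)
  have hint: "h y integrable_on {0..u}" for y u
    using h by (rule integrable_continuous_interval)
  \<comment> \<open>Integrating the bound \<open>C * exp (K * s)\<close> gains a factor
    \<open>1 / K\<close>. This serves twice: for the boundedness of \<open>\<Phi> y\<close> and for
    the contraction constant \<open>L / K\<close>.\<close>
  have bound: "norm (integral {0..u} g) \<le> C * ((exp (K * u) - 1) / K)"
    if "0 \<le> u" "g integrable_on {0..u}" "\<And>s. s \<in> {0..u} \<Longrightarrow> norm (g s) \<le> C * exp (K * s)"
    for g :: "real \<Rightarrow> 'b" and C u
    using integral_norm_bound_integral[OF that(2) _ that(3)]
      has_integral_mult_right[OF has_integral_exp_mult[OF K that(1)], of C]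
    by (simp add: has_integral_iff)
  have \<Phi>b: "norm (\<Phi> y t) \<le> norm x0 + norm (F 0) / K + norm y" for y t
  proof -
    define u where "u = max 0 t"
    have u: "0 \<le> u" by (simp add: u_def)
    have "norm (h y s) \<le> (norm (F 0) + K * norm y) * exp (K * s)" if "s \<in> {0..u}" for s
    proof -
      have "norm (h y s) \<le> norm (F 0) + norm (h y s - F 0)"
        by (metis add.commute diff_add_cancel norm_triangle_ineq)
      also have "\<dots> \<le> norm (F 0) + L * (exp (K * s) * norm (apply_bcontfun y s))"
        using lip[of "exp (K * s) *\<^sub>R apply_bcontfun y s" 0] by (simp add: h_def)
      also have "\<dots> \<le> norm (F 0) * exp (K * s) + K * (exp (K * s) * norm y)"
        using that K L norm_bounded[of y s]
        by (intro add_mono mult_mono) (auto simp: K_def mult_le_cancel_left1)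
      finally show ?thesis by (simp add: algebra_simps)
    qed
    then have "norm (integral {0..u} (h y)) \<le> (norm (F 0) + K * norm y) * ((exp (K * u) - 1) / K)"
      by (rule bound[OF u hint])
    also have "\<dots> \<le> (norm (F 0) / K + norm y) * exp (K * u)"
    proof -
      have "(norm (F 0) + K * norm y) * ((exp (K * u) - 1) / K) = (norm (F 0) / K + norm y) * (exp (K * u) - 1)"
        using K by (simp add: field_simps)
      also have "\<dots> \<le> (norm (F 0) / K + norm y) * exp (K * u)"
        using K by (intro mult_left_mono) auto
      finally show ?thesis .
    qed
    finally have "norm (I y u) \<le> norm x0 * exp (K * u) + (norm (F 0) / K + norm y) * exp (K * u)"
      unfolding I_def using K u
      by (intro norm_triangle_le add_mono) (auto simp: mult_le_cancel_left1)
    then have "exp (- K * u) * norm (I y u) \<le> exp (- K * u) * ((norm x0 + norm (F 0) / K + norm y) * exp (K * u))"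
      by (intro mult_left_mono) (auto simp: algebra_simps)
    also have "\<dots> = norm x0 + norm (F 0) / K + norm y"
      by (simp add: exp_minus)
    finally show ?thesis by (simp add: \<Phi>_def u_def)
  qed
  have \<Phi>: "\<Phi> y \<in> bcontfun" for y using \<Phi>c \<Phi>b by (rule bcontfun_normI)
  define P where "P y = Bcontfun (\<Phi> y)" for y
  have P: "apply_bcontfun (P y) = \<Phi> y" for y by (simp add: P_def Bcontfun_inverse \<Phi>)
  have "dist (P y) (P z) \<le> L / K * dist y z" for y z
  proof (rule dist_bound)
    fix t :: real
    define u where "u = max 0 t"
    have u: "0 \<le> u" by (simp add: u_def)
    have "norm (h y s - h z s) \<le> L * norm (y - z) * exp (K * s)" for s
    proof -
      have "norm (h y s - h z s) \<le> L * (exp (K * s) * norm (apply_bcontfun (y - z) s))"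
        using lip[of "exp (K * s) *\<^sub>R apply_bcontfun y s" "exp (K * s) *\<^sub>R apply_bcontfun z s"]
        by (simp add: h_def flip: scaleR_diff_right)
      also have "\<dots> \<le> L * (exp (K * s) * norm (y - z))"
        using L norm_bounded[of "y - z" s] by (intro mult_mono) auto
      finally show ?thesis by (simp add: algebra_simps)
    qed
    then have "norm (integral {0..u} (\<lambda>s. h y s - h z s)) \<le> L * norm (y - z) * ((exp (K * u) - 1) / K)"
      by (rule bound[OF u integrable_diff[OF hint hint]])
    also have "\<dots> \<le> L * norm (y - z) * (exp (K * u) / K)"
      using K L by (intro mult_left_mono divide_right_mono) auto
    finally have "norm (I y u - I z u) \<le> L * norm (y - z) * (exp (K * u) / K)"
      by (simp add: I_def integral_diff[OF hint hint])
    then have "exp (- K * u) * norm (I y u - I z u) \<le> exp (- K * u) * (L * norm (y - z) * (exp (K * u) / K))"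
      by (intro mult_left_mono) auto
    also have "\<dots> = L / K * dist y z" by (simp add: exp_minus dist_norm)
    finally show "dist (P y t) (P z t) \<le> L / K * dist y z"
      by (simp add: P \<Phi>_def u_def dist_norm flip: scaleR_diff_right)
  qed
  moreover have "0 \<le> L / K" "L / K < 1" using L by (auto simp: K_def)
  ultimately obtain y where y: "P y = y"
    using banach_fix_type[of "L / K" P] by blast
  define x where "x t = exp (K * t) *\<^sub>R apply_bcontfun y t" for t
  have xI: "x t = I y t" if "0 \<le> t" for t
  proof -
    have "x t = exp (K * t) *\<^sub>R \<Phi> y t" using P[of y] by (simp add: x_def y)
    then show ?thesis using that by (simp add: \<Phi>_def exp_minus)
  qed
  show ?thesis
  proof
    show "x 0 = x0" by (simp add: xI I_def)
    fix t :: real assume t: "0 \<le> t"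
    have "((I y) has_vector_derivative F (x t)) (at t within {0..})"
      using I[OF t, of y] by (simp add: h_def x_def)
    then show "(x has_vector_derivative F (x t)) (at t within {0..})"
      by (rule has_vector_derivative_transform[rotated 2]) (use t xI in auto)
  qed
qed

text \<open>Lets the existence theorem, stated for the class \<open>banach\<close>, take a space of
  bounded continuous functions as its state space.\<close>

instance bcontfun :: (metric_space, banach) banach ..

text \<open>The space of real functions on the finite set \<open>A\<close> is not a type, so initial
  value and field are embedded as bounded functions on a discrete space, zero off \<open>A\<close>.
  With the sup norm these form a Banach space, to which the previous theorem applies; a translation
  moves the initial time to \<open>T\<close>.\<close>

lemma finite_system_global_solution:
  fixes F :: "('i \<Rightarrow> real) \<Rightarrow> 'i \<Rightarrow> real"
  assumes A: "finite A" and L: "0 \<le> L"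
    and lip: "\<And>x y i. i \<in> A \<Longrightarrow> \<bar>F x i - F y i\<bar> \<le> L * (\<Sum>j\<in>A. \<bar>x j - y j\<bar>)"
  obtains x :: "real \<Rightarrow> 'i \<Rightarrow> real" where "\<And>i. i \<in> A \<Longrightarrow> x T i = x0 i"
    and "\<And>i t. i \<in> A \<Longrightarrow> T \<le> t \<Longrightarrow> ((\<lambda>t. x t i) has_real_derivative F (x t) i) (at t within {T..})"
proof -
  define emb :: "('i \<Rightarrow> real) \<Rightarrow> 'i discrete \<Rightarrow>\<^sub>C real"
    where "emb f = Bcontfun (\<lambda>d. if of_discrete d \<in> A then f (of_discrete d) else 0)" for f
  have emb: "apply_bcontfun (emb f) d = (if of_discrete d \<in> A then f (of_discrete d) else 0)" for f d
  proof -
    have "(\<lambda>d. if of_discrete d \<in> A then f (of_discrete d) else 0) \<in> bcontfun"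
    proof (rule bcontfun_normI)
      show "continuous_on UNIV (\<lambda>d. if of_discrete d \<in> A then f (of_discrete d) else 0)"
        by (simp add: continuous_on_open_vimage open_discrete)
      show "norm (if of_discrete d \<in> A then f (of_discrete d) else 0) \<le> (\<Sum>j\<in>A. \<bar>f j\<bar>)" for d
        using A by (auto intro: member_le_sum sum_nonneg)
    qed
    then show ?thesis by (simp add: emb_def Bcontfun_inverse)
  qed
  define G where "G z = emb (F (\<lambda>i. apply_bcontfun z (discrete i)))" for z
  have "norm (G z - G w) \<le> L * card A * norm (z - w)" for z w
  proof (rule norm_bound)
    fix d
    \<comment> \<open>The hypothesis measures distances by a sum over \<open>A\<close>; passing to
      the sup norm costs the factor \<open>card A\<close>.\<close>
    have *: "(\<Sum>j\<in>A. \<bar>apply_bcontfun z (discrete j) - apply_bcontfun w (discrete j)\<bar>) \<le> card A * norm (z - w)"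
      using norm_bounded[of "z - w"] by (intro sum_bounded_above) auto
    show "norm (apply_bcontfun (G z - G w) d) \<le> L * card A * norm (z - w)"
    proof (cases "of_discrete d \<in> A")
      case True
      then show ?thesis
        using lip[OF True, of "\<lambda>i. apply_bcontfun z (discrete i)" "\<lambda>i. apply_bcontfun w (discrete i)"]
          mult_left_mono[OF * L]
        by (simp add: G_def emb algebra_simps)
    qed (use L in \<open>simp add: G_def emb\<close>)
  qed
  moreover have "0 \<le> L * card A" using L by simp
  ultimately obtain X where X0: "X 0 = emb x0"
    and X: "\<And>t. 0 \<le> t \<Longrightarrow> (X has_vector_derivative G (X t)) (at t within {0..})"
    using lipschitz_field_global_solution[of "L * card A" G "emb x0"] by blast
  define x where "x t i = apply_bcontfun (X (t - T)) (discrete i)" for t i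
  show ?thesis
  proof
    show "x T i = x0 i" if "i \<in> A" for i using that by (simp add: x_def X0 emb discrete_inverse)
    fix i t assume i: "i \<in> A" and t: "T \<le> t"
    have bl: "bounded_linear (\<lambda>z. apply_bcontfun z (discrete i))"
      by (rule bounded_linear_intro[of _ 1]) (use norm_bounded in auto)
    have "((\<lambda>s. s - T) has_vector_derivative 1) (at t within {T..})"
      by (auto intro!: derivative_eq_intros)
    moreover have "(X has_vector_derivative G (X (t - T))) (at (t - T) within (\<lambda>s. s - T) ` {T..})"
      by (rule has_vector_derivative_within_subset[OF X]) (use t in auto)
    ultimately have "((X \<circ> (\<lambda>s. s - T)) has_vector_derivative (1 *\<^sub>R G (X (t - T)))) (at t within {T..})"
      by (rule vector_diff_chain_within)
    from bounded_linear.has_vector_derivative[OF bl this]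
    show "((\<lambda>t. x t i) has_real_derivative F (x t) i) (at t within {T..})"
      using i by (simp add: o_def x_def[abs_def] G_def emb discrete_inverse has_real_derivative_iff_has_vector_derivative)
  qed
qed

section \<open>Uniqueness and positivity by Gronwall arguments\<close>

lemma DERIV_within_nonpos_imp_le:
  fixes g :: "real \<Rightarrow> real"
  assumes "a \<le> b"
    and "\<And>s. s \<in> {a..b} \<Longrightarrow> (g has_real_derivative g' s) (at s within {a..b})"
    and "\<And>s. s \<in> {a<..<b} \<Longrightarrow> g' s \<le> 0"
  shows "g b \<le> g a"
proof (cases "a = b")
  case False
  then have "a < b" using assms(1) by simp
  from mvt_simple[OF this, of g "\<lambda>s. (*) (g' s)"] obtain s
    where "s \<in> {a<..<b}" "g b - g a = g' s * (b - a)"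
    using assms(2) by (auto simp: has_field_derivative_def)
  then show ?thesis
    using assms(3)[of s] \<open>a < b\<close> by (smt (verit) mult_nonneg_nonpos2)
qed simp

text \<open>Gronwall's argument: the squared Euclidean distance \<phi> satisfies
  \<open>\<phi>' t \<le> C * \<phi> t\<close>, so \<open>exp (- C * t) * \<phi> t\<close> is
  nonincreasing, and it starts at 0.\<close>

lemma finite_system_unique:
  fixes F :: "('i \<Rightarrow> real) \<Rightarrow> 'i \<Rightarrow> real" and x y :: "real \<Rightarrow> 'i \<Rightarrow> real"
  assumes A: "finite A" and L: "0 \<le> L"
    and lip: "\<And>x y i. i \<in> A \<Longrightarrow> \<bar>F x i - F y i\<bar> \<le> L * (\<Sum>j\<in>A. \<bar>x j - y j\<bar>)"
    and ab: "a \<le> b" and eq: "\<And>i. i \<in> A \<Longrightarrow> x a i = y a i"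
    and x: "\<And>i t. i \<in> A \<Longrightarrow> t \<in> {a..b} \<Longrightarrow> ((\<lambda>t. x t i) has_real_derivative F (x t) i) (at t within {a..b})"
    and y: "\<And>i t. i \<in> A \<Longrightarrow> t \<in> {a..b} \<Longrightarrow> ((\<lambda>t. y t i) has_real_derivative F (y t) i) (at t within {a..b})"
    and i: "i \<in> A"
  shows "x b i = y b i"
proof -
  \<comment> \<open>The 2 comes from differentiating squares, \<open>card A\<close> from
    Cauchy-Schwarz for the sum of the differences.\<close>
  define C where "C = 2 * L * card A"
  define \<phi> where "\<phi> t = (\<Sum>i\<in>A. (x t i - y t i)\<^sup>2)" for t
  define \<phi>' where "\<phi>' t = (\<Sum>i\<in>A. 2 * (x t i - y t i) * (F (x t) i - F (y t) i))" for t
  have "exp (- C * b) * \<phi> b \<le> exp (- C * a) * \<phi> a"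
  proof (rule DERIV_within_nonpos_imp_le[OF ab])
    show "((\<lambda>t. exp (- C * t) * \<phi> t) has_real_derivative exp (- C * t) * (\<phi>' t - C * \<phi> t)) (at t within {a..b})"
      if "t \<in> {a..b}" for t
      unfolding \<phi>_def \<phi>'_def using that
      by (auto intro!: derivative_eq_intros x y simp: algebra_simps)
    fix t
    define d where "d i = \<bar>x t i - y t i\<bar>" for i
    have "\<phi>' t \<le> (\<Sum>i\<in>A. 2 * d i * (L * (\<Sum>j\<in>A. d j)))"
      unfolding \<phi>'_def
    proof (rule sum_mono)
      fix i assume "i \<in> A"
      have "2 * (x t i - y t i) * (F (x t) i - F (y t) i) \<le> 2 * (\<bar>x t i - y t i\<bar> * \<bar>F (x t) i - F (y t) i\<bar>)"
        using abs_ge_self[of "(x t i - y t i) * (F (x t) i - F (y t) i)"]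
        by (simp only: abs_mult mult.assoc)
      also have "\<dots> \<le> 2 * (d i * (L * (\<Sum>j\<in>A. d j)))"
        using lip[OF \<open>i \<in> A\<close>, of "x t" "y t"] unfolding d_def by (intro mult_left_mono) auto
      finally show "2 * (x t i - y t i) * (F (x t) i - F (y t) i) \<le> 2 * d i * (L * (\<Sum>j\<in>A. d j))"
        by (simp add: mult.assoc)
    qed
    also have "\<dots> = 2 * L * (\<Sum>i\<in>A. d i)\<^sup>2"
      by (simp add: power2_eq_square sum_distrib_left sum_distrib_right mult_ac)
    also have "\<dots> \<le> 2 * L * (card A * (\<Sum>i\<in>A. (d i)\<^sup>2))"
      using L sum_squared_le_sum_of_squares[where f = d and I = A] by (intro mult_left_mono) (auto simp: mult.commute)
    also have "\<dots> = C * \<phi> t" by (simp add: C_def \<phi>_def d_def)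
    finally show "exp (- C * t) * (\<phi>' t - C * \<phi> t) \<le> 0" by (simp add: mult_nonneg_nonpos)
  qed
  then have "\<phi> b \<le> 0" using eq by (simp add: \<phi>_def mult_le_0_iff)
  moreover have "0 \<le> \<phi> b" by (simp add: \<phi>_def sum_nonneg)
  ultimately have "(x b i - y b i)\<^sup>2 = 0"
    using i A by (simp add: \<phi>_def sum_nonneg_eq_0_iff)
  then show ?thesis by simp
qed

text \<open>Up to the first time \<open>c\<close> with \<open>u c \<le> 0\<close>, the bound makes
  \<open>exp (M * s) * u s\<close> nondecreasing, so it cannot have dropped from a positive value to
  a nonpositive one.\<close>

lemma positive_of_DERIV_ge:
  fixes u :: "real \<Rightarrow> real"
  assumes u: "\<And>s. a \<le> s \<Longrightarrow> (u has_real_derivative u' s) (at s within {a..})"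
    and ge: "\<And>s. a \<le> s \<Longrightarrow> - M * \<bar>u s\<bar> \<le> u' s" and "0 < u a" "a \<le> b"
  shows "0 < u b"
proof (rule ccontr)
  assume neg: "\<not> 0 < u b"
  have "continuous_on {a..} u"
    using u by (meson DERIV_continuous_on atLeast_iff)
  then have cont: "continuous_on {a..b} u" by (rule continuous_on_subset) auto
  define S where "S = {s \<in> {a..b}. u s \<le> 0}"
  have "closed S"
    unfolding S_def using cont by (intro continuous_on_closed_Collect_le continuous_intros) auto
  moreover have "b \<in> S" using neg assms(4) by (simp add: S_def)
  moreover have bdd: "bdd_below S" by (intro bdd_belowI[of _ a]) (auto simp: S_def)
  ultimately have c: "Inf S \<in> S" using closed_contains_Inf by blast
  define c where "c = Inf S"
  have c: "a \<le> c" "c \<le> b" "u c \<le> 0" using c by (auto simp: S_def c_def)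
  have pos: "0 < u s" if "s \<in> {a<..<c}" for s
    using that c cInf_lower[OF _ bdd, of s] unfolding c_def[symmetric] by (force simp: S_def)
  have "- (exp (M * c) * u c) \<le> - (exp (M * a) * u a)"
  proof (rule DERIV_within_nonpos_imp_le[OF c(1)])
    show "((\<lambda>s. - (exp (M * s) * u s)) has_real_derivative - (exp (M * s) * (M * u s + u' s))) (at s within {a..c})"
      if "s \<in> {a..c}" for s
    proof -
      have "(u has_real_derivative u' s) (at s within {a..c})"
        using that by (intro has_field_derivative_subset[OF u]) auto
      then show ?thesis by (auto intro!: derivative_eq_intros simp: algebra_simps)
    qed
    show "- (exp (M * s) * (M * u s + u' s)) \<le> 0" if "s \<in> {a<..<c}" for s
      using that pos[OF that] ge[of s] by (simp add: abs_of_pos)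
  qed
  moreover have "exp (M * c) * u c \<le> 0" using c(3) by (simp add: mult_le_0_iff)
  ultimately have "exp (M * a) * u a \<le> 0" by linarith
  then show False using assms(3) by (simp add: mult_le_0_iff)
qed

section \<open>Paths and distances\<close>

lemma path_weight_simps [simp]:
  "path_weight \<omega> [] = 0" "path_weight \<omega> [v] = 0"
  "path_weight \<omega> (u # v # p) = \<omega> {u, v} + path_weight \<omega> (v # p)"
  by (simp_all add: path_weight_def sum.lessThan_Suc_shift del: sum.lessThan_Suc)

lemma path_weight_append:
  "path_weight \<omega> (p @ v # q) = path_weight \<omega> (p @ [v]) + path_weight \<omega> (v # q)"
proof (induction p)
  case (Cons a p)
  then show ?case by (cases p) auto
qed simp

lemma path_weight_nonneg:
  assumes "successively (\<lambda>x y. {x, y} \<in> E) p" "\<forall>e\<in>E. 0 \<le> \<omega> e"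
  shows "0 \<le> path_weight \<omega> p"
  using assms(1)
proof (induction p rule: induct_list012)
  case (3 x y zs)
  then show ?case using assms(2) by (auto simp: add_nonneg_nonneg)
qed auto

lemma path_weight_pos:
  assumes "successively (\<lambda>x y. {x, y} \<in> E) (u # v # p)" "\<forall>e\<in>E. 0 < \<omega> e"
  shows "0 < path_weight \<omega> (u # v # p)"
  using assms path_weight_nonneg[of E "v # p" \<omega>] by (auto simp: less_imp_le add_pos_nonneg)

lemma path_weight_cong:
  assumes "successively (\<lambda>x y. {x, y} \<in> E) p" "\<And>e. e \<in> E \<Longrightarrow> \<omega> e = \<omega>' e"
  shows "path_weight \<omega> p = path_weight \<omega>' p"
  using assms(1)
proof (induction p rule: induct_list012)
  case (3 x y zs)
  then show ?case using assms(2) by auto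
qed auto

lemma path_weight_diff_le:
  fixes \<omega> \<omega>' :: "'a set \<Rightarrow> real"
  assumes "successively (\<lambda>x y. {x, y} \<in> E) p" and "finite E"
  shows "\<bar>path_weight \<omega> p - path_weight \<omega>' p\<bar> \<le> length p * (\<Sum>e\<in>E. \<bar>\<omega> e - \<omega>' e\<bar>)"
  using assms(1)
proof (induction p rule: induct_list012)
  case (2 x)
  then show ?case by (simp add: sum_nonneg)
next
  case (3 x y zs)
  have "\<bar>\<omega> {x, y} - \<omega>' {x, y}\<bar> \<le> (\<Sum>e\<in>E. \<bar>\<omega> e - \<omega>' e\<bar>)"
    using 3(3) assms(2) by (intro member_le_sum[of _ E "\<lambda>e. \<bar>\<omega> e - \<omega>' e\<bar>"]) auto
  then show ?case using 3 by (simp add: algebra_simps)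
qed auto

text \<open>Cutting out a loop at a repeated vertex shortens the list and removes nonnegative
  weight. For positive weights the loss is strict, which later ensures that a shortened detour
  around an edge is not the edge itself.\<close>

lemma path_between_distinct:
  assumes "path_between E u v p" and nonneg: "\<forall>e\<in>E. 0 \<le> \<omega> e"
  obtains q where "path_between E u v q" "distinct q" "path_weight \<omega> q \<le> path_weight \<omega> p"
    and "\<forall>e\<in>E. 0 < \<omega> e \<Longrightarrow> q = p \<or> path_weight \<omega> q < path_weight \<omega> p"
proof -
  have "\<exists>q. path_between E u v q \<and> distinct q \<and> path_weight \<omega> q \<le> path_weight \<omega> p \<and>
    ((\<forall>e\<in>E. 0 < \<omega> e) \<longrightarrow> q = p \<or> path_weight \<omega> q < path_weight \<omega> p)"
    using assms(1)
  proof (induction "length p" arbitrary: p rule: less_induct)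
    case less
    show ?case
    proof (cases "distinct p")
      case False
      then obtain a b c y where p: "p = a @ [y] @ b @ [y] @ c"
        using not_distinct_decomp by blast
      define r where "r = a @ [y] @ c"
      have loop: "successively (\<lambda>x y. {x, y} \<in> E) (y # b @ [y])"
        using less.prems successively_append_iff[of "\<lambda>x y. {x, y} \<in> E" a "(y # b @ [y]) @ c"]
          successively_append_iff[of "\<lambda>x y. {x, y} \<in> E" "y # b @ [y]" c]
        unfolding p path_between_def by simp
      have r: "path_between E u v r"
      proof -
        have "successively (\<lambda>x y. {x, y} \<in> E) (a @ y # c)"
          using less.prems successively_append_iff[of "\<lambda>x y. {x, y} \<in> E" "a @ [y]" "b @ y # c"]
            successively_append_iff[of "\<lambda>x y. {x, y} \<in> E" "a @ y # b" "y # c"]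
            successively_append_iff[of "\<lambda>x y. {x, y} \<in> E" a "[y]"] successively_append_iff[of "\<lambda>x y. {x, y} \<in> E" a "y # c"]
          unfolding p path_between_def by simp
        moreover have "hd (a @ y # c) = u" "last (a @ y # c) = v"
          using less.prems unfolding p path_between_def by (cases a; simp)+
        ultimately show ?thesis by (simp add: r_def path_between_def)
      qed
      have w: "path_weight \<omega> p = path_weight \<omega> r + path_weight \<omega> (y # b @ [y])"
        using path_weight_append[of \<omega> a y "b @ y # c"] path_weight_append[of \<omega> "y # b" y c]
          path_weight_append[of \<omega> a y c]
        by (simp add: p r_def)
      have "0 \<le> path_weight \<omega> (y # b @ [y])"
        using loop nonneg by (rule path_weight_nonneg)
      moreover have "0 < path_weight \<omega> (y # b @ [y])" if "\<forall>e\<in>E. 0 < \<omega> e"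
        using loop that path_weight_pos[of E y] by (cases "b @ [y]") auto
      moreover have "length r < length p" by (simp add: p r_def)
      then obtain q where "path_between E u v q" "distinct q" "path_weight \<omega> q \<le> path_weight \<omega> r"
        using less.hyps[OF _ r] by blast
      ultimately show ?thesis
        using w by (intro exI[of _ q]) auto
    qed (use less.prems in auto)
  qed
  then show ?thesis using that by blast
qed

lemma path_between_subset:
  assumes "path_between E u v p" "simple_graph V E" "u \<in> V"
  shows "set p \<subseteq> V"
proof -
  have "successively (\<lambda>x y. {x, y} \<in> E) p \<Longrightarrow> hd p \<in> V \<Longrightarrow> set p \<subseteq> V"
  proof (induction p rule: induct_list012)
    case (3 x y zs)
    then have "{x, y} \<subseteq> V" using assms(2) by (auto simp: simple_graph_def)
    then show ?case using 3 by auto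
  qed auto
  then show ?thesis using assms(1,3) by (auto simp: path_between_def)
qed

lemma path_between_rev: "path_between E u v p \<Longrightarrow> path_between E v u (rev p)"
  by (simp add: path_between_def hd_rev last_rev insert_commute)

lemma path_weight_rev: "path_weight \<omega> (rev p) = path_weight \<omega> p"
proof (induction p rule: induct_list012)
  case (3 x y zs)
  then show ?case using path_weight_append[of \<omega> "rev zs" y "[x]"] by (simp add: insert_commute)
qed auto

lemma wdist_commute: "wdist E \<omega> u v = wdist E \<omega> v u"
proof -
  have "{path_weight \<omega> p | p. path_between E a b p} \<subseteq> {path_weight \<omega> p | p. path_between E b a p}" for a b
  proof
    fix c assume "c \<in> {path_weight \<omega> p | p. path_between E a b p}"
    then obtain p where "c = path_weight \<omega> p" "path_between E a b p" by blast
    then have "c = path_weight \<omega> (rev p)" "path_between E b a (rev p)"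
      by (simp_all add: path_between_rev path_weight_rev)
    then show "c \<in> {path_weight \<omega> p | p. path_between E b a p}" by blast
  qed
  then show ?thesis unfolding wdist_def by (intro arg_cong[of _ _ Inf] subset_antisym)
qed

lemma wdist_cong:
  assumes "\<And>e. e \<in> E \<Longrightarrow> \<omega> e = \<omega>' e"
  shows "wdist E \<omega> u v = wdist E \<omega>' u v"
proof -
  have "path_weight \<omega> p = path_weight \<omega>' p" if "path_between E u v p" for p
    using that assms by (intro path_weight_cong[of E]) (auto simp: path_between_def)
  then show ?thesis
    unfolding wdist_def setcompr_eq_image by (intro arg_cong[of _ _ Inf] image_cong) auto
qed

lemma wdist_le:
  assumes "path_between E u v p" "\<forall>e\<in>E. 0 \<le> \<omega> e"
  shows "wdist E \<omega> u v \<le> path_weight \<omega> p"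
  unfolding wdist_def
  using assms path_weight_nonneg by (intro cInf_lower bdd_belowI[of _ 0]) (auto simp: path_between_def)

lemma wdist_greatest:
  assumes "path_between E u v p" "\<And>q. path_between E u v q \<Longrightarrow> c \<le> path_weight \<omega> q"
  shows "c \<le> wdist E \<omega> u v"
  unfolding wdist_def using assms by (intro cInf_greatest) auto

lemma wdist_nonneg:
  assumes "path_between E u v p" "\<forall>e\<in>E. 0 \<le> \<omega> e"
  shows "0 \<le> wdist E \<omega> u v"
  using assms path_weight_nonneg by (intro wdist_greatest) (auto simp: path_between_def)

text \<open>By loop removal only repetition-free paths matter. These have at most
  \<open>card V\<close> vertices, and the weight of each edge on them changes by at most the total
  change over \<open>E\<close>.\<close>

lemma wdist_lipschitz_le:
  fixes \<omega> \<omega>' :: "'a set \<Rightarrow> real"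
  assumes V: "finite V" "simple_graph V E" and u: "u \<in> V"
    and nonneg: "\<forall>e\<in>E. 0 \<le> \<omega> e" "\<forall>e\<in>E. 0 \<le> \<omega>' e"
  shows "\<bar>wdist E \<omega> u v - wdist E \<omega>' u v\<bar> \<le> card V * (\<Sum>e\<in>E. \<bar>\<omega> e - \<omega>' e\<bar>)"
proof (cases "\<exists>p. path_between E u v p")
  case True
  then obtain p where p: "path_between E u v p" ..
  have E: "finite E"
    using V by (intro finite_subset[of E "Pow V"]) (auto simp: simple_graph_def)
  have *: "wdist E \<alpha> u v \<le> wdist E \<beta> u v + card V * (\<Sum>e\<in>E. \<bar>\<alpha> e - \<beta> e\<bar>)"
    if \<alpha>: "\<forall>e\<in>E. 0 \<le> \<alpha> e" and \<beta>: "\<forall>e\<in>E. 0 \<le> \<beta> e" for \<alpha> \<beta> :: "'a set \<Rightarrow> real"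
  proof -
    have "wdist E \<alpha> u v - card V * (\<Sum>e\<in>E. \<bar>\<alpha> e - \<beta> e\<bar>) \<le> wdist E \<beta> u v"
    proof (rule wdist_greatest[OF p])
      fix q assume "path_between E u v q"
      then obtain r where r: "path_between E u v r" "distinct r" "path_weight \<beta> r \<le> path_weight \<beta> q"
        using path_between_distinct[OF _ \<beta>] by metis
      have "length r \<le> card V"
        using path_between_subset[OF r(1) V(2) u] r(2) V(1) by (metis card_mono distinct_card)
      then have "length r * (\<Sum>e\<in>E. \<bar>\<alpha> e - \<beta> e\<bar>) \<le> card V * (\<Sum>e\<in>E. \<bar>\<alpha> e - \<beta> e\<bar>)"
        by (intro mult_right_mono) (auto simp: sum_nonneg)
      moreover have "\<bar>path_weight \<alpha> r - path_weight \<beta> r\<bar> \<le> length r * (\<Sum>e\<in>E. \<bar>\<alpha> e - \<beta> e\<bar>)"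
        using r(1) E by (intro path_weight_diff_le) (auto simp: path_between_def)
      moreover have "wdist E \<alpha> u v \<le> path_weight \<alpha> r" using r(1) \<alpha> by (rule wdist_le)
      ultimately show "wdist E \<alpha> u v - card V * (\<Sum>e\<in>E. \<bar>\<alpha> e - \<beta> e\<bar>) \<le> path_weight \<beta> q"
        using r(3) by linarith
    qed
    then show ?thesis by simp
  qed
  show ?thesis using *[OF nonneg] *[OF nonneg(2,1)] by (simp add: abs_le_iff abs_minus_commute)
next
  case False
  \<comment> \<open>Without a path both distances are \<open>Inf {}\<close>, so their difference
    vanishes.\<close>
  then show ?thesis by (simp add: wdist_def sum_nonneg)
qed

section \<open>Degenerate edges and their witnesses\<close>

lemma degenerate_edges_subset: "degenerate_edges E \<omega> \<subseteq> E"
  by (auto simp: degenerate_edges_def)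

lemma degenerate_edges_cong:
  assumes "\<And>e. e \<in> E \<Longrightarrow> \<omega> e = \<omega>' e"
  shows "degenerate_edges E \<omega> = degenerate_edges E \<omega>'"
proof -
  have "degenerate_edges E \<alpha> \<subseteq> degenerate_edges E \<beta>" if "\<And>e. e \<in> E \<Longrightarrow> \<alpha> e = \<beta> e"
    for \<alpha> \<beta> :: "'a set \<Rightarrow> real"
  proof
    fix e assume "e \<in> degenerate_edges E \<alpha>"
    then obtain x y p where *: "e \<in> E" "e = {x, y}" "path_between E x y p" "p \<noteq> [x, y]" "path_weight \<alpha> p \<le> \<alpha> e"
      unfolding degenerate_edges_def by blast
    moreover have "path_weight \<alpha> p = path_weight \<beta> p"
      using *(3) that by (intro path_weight_cong[of E]) (auto simp: path_between_def)
    ultimately have "path_weight \<beta> p \<le> \<beta> e" using that[of e] by simp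
    with * show "e \<in> degenerate_edges E \<beta>" unfolding degenerate_edges_def by blast
  qed
  from this[of \<omega> \<omega>'] this[of \<omega>' \<omega>] show ?thesis using assms by auto
qed

lemma path_between_mono: "path_between E u v p \<Longrightarrow> E \<subseteq> E' \<Longrightarrow> path_between E' u v p"
  unfolding path_between_def using successively_mono[of "\<lambda>x y. {x, y} \<in> E" p "\<lambda>x y. {x, y} \<in> E'"] by blast

text \<open>A path in the smaller graph is also one in \<open>E\<close>, with the same weight. An
  edge that is degenerate after the deletion was thus degenerate before and has already been
  removed, so one round of surgery suffices.\<close>

lemma degenerate_edges_diff: "degenerate_edges (E - degenerate_edges E \<omega>) \<omega> = {}"
proof -
  have "degenerate_edges E' \<omega> \<subseteq> degenerate_edges E \<omega>" if "E' \<subseteq> E" for E'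
    unfolding degenerate_edges_def using that path_between_mono[OF _ that] by blast
  from this[of "E - degenerate_edges E \<omega>"] show ?thesis
    using degenerate_edges_subset[of "E - degenerate_edges E \<omega>" \<omega>] by blast
qed

lemma simple_graph_edgeD:
  assumes "simple_graph V E" "{x, y} \<in> E"
  shows "x \<in> V" "y \<in> V" "x \<noteq> y"
proof -
  have "{x, y} \<subseteq> V \<and> card {x, y} = 2" using assms by (simp only: simple_graph_def)
  then show "x \<in> V" "y \<in> V" "x \<noteq> y" by auto
qed

lemma simple_graph_edgeE:
  assumes "simple_graph V E" "e \<in> E"
  obtains x y where "e = {x, y}" "x \<in> V" "y \<in> V" "x \<noteq> y"
proof -
  have "e \<subseteq> V" "card e = 2" using assms by (auto simp: simple_graph_def)
  then show ?thesis using that by (auto simp: card_2_iff)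
qed

lemma wdist_edge_le:
  assumes "{x, y} \<in> E" "\<forall>e\<in>E. 0 \<le> \<omega> e"
  shows "wdist E \<omega> x y \<le> \<omega> {x, y}"
  using wdist_le[of E x y "[x, y]" \<omega>] assms by (simp add: path_between_def)

lemma wdist_edge:
  assumes "{x, y} \<in> E" "\<forall>e\<in>E. 0 \<le> \<omega> e" "degenerate_edges E \<omega> = {}"
  shows "wdist E \<omega> x y = \<omega> {x, y}"
proof (rule antisym)
  show "\<omega> {x, y} \<le> wdist E \<omega> x y"
  proof (rule wdist_greatest[of E x y "[x, y]"])
    fix q assume "path_between E x y q"
    moreover have "{x, y} \<notin> degenerate_edges E \<omega>" using assms(3) by simp
    ultimately show "\<omega> {x, y} \<le> path_weight \<omega> q"
      using assms(1) unfolding degenerate_edges_def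
      by (cases "q = [x, y]") (simp, metis (mono_tags, lifting) linorder_le_cases mem_Collect_eq)
  qed (use assms(1) in \<open>simp add: path_between_def\<close>)
qed (use assms in \<open>auto intro: wdist_edge_le\<close>)

text \<open>The possible witnesses of degeneracy, depending on the graph but not on the weight;
  \<open>distinct\<close> keeps them finite in number.\<close>

definition detours :: "'a set set \<Rightarrow> ('a set \<times> 'a list) set" where
  "detours E = {(e, p). e \<in> E \<and> distinct p \<and>
     (\<exists>x y. e = {x, y} \<and> path_between E x y p \<and> p \<noteq> [x, y])}"

lemma finite_detours:
  assumes V: "finite V" "simple_graph V E"
  shows "finite (detours E)"
proof (rule finite_subset)
  show "detours E \<subseteq> E \<times> {p. set p \<subseteq> V \<and> distinct p}"
  proof
    fix ep assume "ep \<in> detours E"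
    then obtain e p x y where *: "ep = (e, p)" "e \<in> E" "distinct p" "e = {x, y}" "path_between E x y p"
      by (auto simp: detours_def)
    then show "ep \<in> E \<times> {p. set p \<subseteq> V \<and> distinct p}"
      using path_between_subset[OF *(5) V(2)] simple_graph_edgeD[OF V(2)] by auto
  qed
  have "finite E"
    using V by (intro finite_subset[of E "Pow V"]) (auto simp: simple_graph_def)
  then show "finite (E \<times> {p. set p \<subseteq> V \<and> distinct p})"
    using finite_subset_distinct[OF V(1)] by simp
qed

text \<open>Loop removal makes a witness repetition-free. It cannot turn it into
  \<open>[x, y]\<close>: the edge would then be strictly shorter than a path of weight at most
  \<open>\<omega> {x, y}\<close>.\<close>

lemma degenerate_edges_nonempty_iff:
  assumes pos: "\<forall>e\<in>E. 0 < \<omega> e"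
  shows "degenerate_edges E \<omega> \<noteq> {} \<longleftrightarrow> (\<exists>(e, p)\<in>detours E. path_weight \<omega> p \<le> \<omega> e)"
proof
  assume "degenerate_edges E \<omega> \<noteq> {}"
  then obtain x y p where *: "{x, y} \<in> E" "path_between E x y p" "p \<noteq> [x, y]" "path_weight \<omega> p \<le> \<omega> {x, y}"
    by (auto simp: degenerate_edges_def)
  obtain q where q: "path_between E x y q" "distinct q" "q = p \<or> path_weight \<omega> q < path_weight \<omega> p"
    using path_between_distinct[OF *(2)] pos less_imp_le by metis
  then have "q \<noteq> [x, y]" "path_weight \<omega> q \<le> \<omega> {x, y}" using * by auto
  then show "\<exists>(e, p)\<in>detours E. path_weight \<omega> p \<le> \<omega> e"
    using * q by (auto simp: detours_def)
next
  assume "\<exists>(e, p)\<in>detours E. path_weight \<omega> p \<le> \<omega> e"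
  then obtain e p where "(e, p) \<in> detours E" "path_weight \<omega> p \<le> \<omega> e" by blast
  then have "e \<in> degenerate_edges E \<omega>" unfolding detours_def degenerate_edges_def by blast
  then show "degenerate_edges E \<omega> \<noteq> {}" by blast
qed

section \<open>Curvature\<close>

lemma Inf_affine_image:
  fixes S :: "real set"
  assumes "S \<noteq> {}" "bdd_below S" "0 \<le> a"
  shows "Inf ((\<lambda>s. c + a * s) ` S) = c + a * Inf S"
proof -
  have "mono (\<lambda>s. c + a * s)" using assms(3) by (auto intro!: monoI mult_left_mono)
  from continuous_at_Inf_mono[OF this _ assms(1,2)] show ?thesis
    by (simp add: continuous_intros)
qed

text \<open>The weight is no parameter because it moves with time; the edge set is one, so that the
  results can be reinterpreted after each surgery.\<close>

locale weighted_graph =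
  fixes V :: "'a set" and E :: "'a set set" and m1 :: "'a \<Rightarrow> real" and m2 :: "'a set \<Rightarrow> real"
  assumes finite_V: "finite V" and graph: "simple_graph V E"
    and m1_pos: "x \<in> V \<Longrightarrow> 0 < m1 x" and m2_pos: "e \<in> E \<Longrightarrow> 0 < m2 e"
begin

lemma finite_E: "finite E"
  using finite_V graph by (intro finite_subset[of E "Pow V"]) (auto simp: simple_graph_def)

lemmas edgeD = simple_graph_edgeD[OF graph]

text \<open>Row \<open>x\<close> of the generator of the random walk: the derivative of the kernel
  at \<open>x\<close> with respect to \<epsilon>.\<close>

definition rate :: "'a \<Rightarrow> 'a \<Rightarrow> real" where
  "rate x u = (if u = x then - Deg E m1 m2 x else if {x, u} \<in> E then m2 {x, u} / m1 x else 0)"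

lemma kernel_eq: "kernel E m1 m2 \<epsilon> x u = (if u = x then 1 else 0) + \<epsilon> * rate x u"
  by (simp add: kernel_def rate_def)

lemma rate_nonneg: "x \<in> V \<Longrightarrow> u \<noteq> x \<Longrightarrow> 0 \<le> rate x u"
  using m1_pos m2_pos by (simp add: rate_def less_imp_le)

lemma sum_rate_off_diagonal:
  assumes "x \<in> V"
  shows "(\<Sum>u\<in>V - {x}. rate x u) = Deg E m1 m2 x"
proof -
  have "{y. {x, y} \<in> E} \<subseteq> V - {x}" using edgeD by blast
  then have "(\<Sum>y | {x, y} \<in> E. m2 {x, y} / m1 x) = (\<Sum>u\<in>V - {x}. rate x u)"
    using finite_V by (intro sum.mono_neutral_cong_left) (auto simp: rate_def)
  then show ?thesis by (simp add: Deg_def sum_divide_distrib)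
qed

lemma Deg_nonneg: "x \<in> V \<Longrightarrow> 0 \<le> Deg E m1 m2 x"
  using rate_nonneg by (subst sum_rate_off_diagonal[symmetric]) (auto intro!: sum_nonneg)

lemma rate_le_Deg:
  assumes "x \<in> V" "u \<in> V" "u \<noteq> x"
  shows "rate x u \<le> Deg E m1 m2 x"
proof -
  have "rate x u \<le> (\<Sum>u\<in>V - {x}. rate x u)"
    using assms finite_V by (intro member_le_sum) (auto simp: rate_nonneg)
  with assms show ?thesis by (simp add: sum_rate_off_diagonal)
qed

text \<open>
  For small \<open>\<epsilon>\<close>, the couplings of \<open>m\<^sub>x\<^sup>\<epsilon>\<close> and \<open>m\<^sub>y\<^sup>\<epsilon>\<close> are exactly the matrices \<open>\<delta>\<^sub>(\<^sub>x\<^sub>,\<^sub>y\<^sub>) + \<epsilon> B\<close> with \<open>B\<close> in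
  the following compact set, which depends neither on \<open>\<epsilon>\<close> nor on the weight.
\<close>

definition plans :: "'a \<Rightarrow> 'a \<Rightarrow> ('a \<Rightarrow> 'a \<Rightarrow> real) set" where
  "plans x y = {B. (\<forall>u\<in>V. \<forall>v\<in>V. (u, v) \<noteq> (x, y) \<longrightarrow> 0 \<le> B u v) \<and>
     (\<forall>u\<in>V. (\<Sum>v\<in>V. B u v) = rate x u) \<and> (\<forall>v\<in>V. (\<Sum>u\<in>V. B u v) = rate y v)}"

definition cost :: "('a \<Rightarrow> 'a \<Rightarrow> real) \<Rightarrow> ('a \<Rightarrow> 'a \<Rightarrow> real) \<Rightarrow> real" where
  "cost d B = (\<Sum>u\<in>V. \<Sum>v\<in>V. d u v * B u v)"

text \<open>The right derivative at \<epsilon> = 0 of the Wasserstein distance between the two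
  kernels; see \<open>wasserstein_kernel\<close>.\<close>

definition drift :: "('a \<Rightarrow> 'a \<Rightarrow> real) \<Rightarrow> 'a \<Rightarrow> 'a \<Rightarrow> real" where
  "drift d x y = Inf (cost d ` plans x y)"

section \<open>Existence of plans and bounds on their entries\<close>

lemma plans_nonempty:
  assumes x: "x \<in> V" and y: "y \<in> V"
  shows "plans x y \<noteq> {}"
proof -
  \<comment> \<open>The first-order term in \<epsilon> of the product coupling of the two
    kernels.\<close>
  define B where "B u v = (if u = x then if v = y then - Deg E m1 m2 x - Deg E m1 m2 y else rate y v
    else if v = y then rate x u else 0)" for u v
  have rx: "rate x x = - Deg E m1 m2 x" "rate y y = - Deg E m1 m2 y" by (simp_all add: rate_def)
  have "(\<Sum>v\<in>V. B u v) = rate x u" if u: "u \<in> V" for u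
  proof (cases "u = x")
    case True
    have "(\<Sum>v\<in>V - {y}. B u v) = Deg E m1 m2 y"
      using sum_rate_off_diagonal[OF y] by (simp add: B_def True)
    then show ?thesis using y finite_V by (simp add: sum.remove[of V y] rx True B_def)
  next
    case False
    then show ?thesis using y finite_V by (simp add: B_def)
  qed
  moreover have "(\<Sum>u\<in>V. B u v) = rate y v" if v: "v \<in> V" for v
  proof (cases "v = y")
    case True
    have "(\<Sum>u\<in>V - {x}. B u v) = Deg E m1 m2 x"
      using sum_rate_off_diagonal[OF x] by (simp add: B_def True)
    then show ?thesis using x finite_V by (simp add: sum.remove[of V x] rx True B_def)
  next
    case False
    then show ?thesis using x finite_V by (simp add: B_def cong: if_cong)
  qed
  ultimately have "B \<in> plans x y"
    using rate_nonneg x y by (auto simp: plans_def B_def)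
  then show ?thesis by blast
qed

lemma plans_transpose: "B \<in> plans x y \<Longrightarrow> (\<lambda>u v. B v u) \<in> plans y x"
  by (auto simp: plans_def)

text \<open>A row \<open>u \<noteq> x\<close> or a column \<open>v \<noteq> y\<close> avoids the
  only entry that may be negative, so each of its entries is at most its sum.\<close>

lemma plans_le:
  assumes B: "B \<in> plans x y" and V: "x \<in> V" "y \<in> V" "u \<in> V" "v \<in> V"
  shows "u \<noteq> x \<Longrightarrow> B u v \<le> rate x u" "v \<noteq> y \<Longrightarrow> B u v \<le> rate y v"
proof -
  assume "u \<noteq> x"
  then have "B u v \<le> (\<Sum>v\<in>V. B u v)"
    using B V finite_V by (intro member_le_sum) (auto simp: plans_def)
  then show "B u v \<le> rate x u" using B V by (simp add: plans_def)
next
  assume "v \<noteq> y"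
  then have "B u v \<le> (\<Sum>u\<in>V. B u v)"
    using B V finite_V by (intro member_le_sum[of u V "\<lambda>u. B u v"]) (auto simp: plans_def)
  then show "B u v \<le> rate y v" using B V by (simp add: plans_def)
qed

text \<open>In row \<open>x\<close> the entry at \<open>y\<close> is minus the degree of
  \<open>x\<close> minus the other entries. These are nonnegative and, by their columns, at most
  \<open>rate y v\<close>, which add up to the degree of \<open>y\<close>.\<close>

lemma plans_diagonal:
  assumes B: "B \<in> plans x y" and V: "x \<in> V" "y \<in> V"
  shows "- (Deg E m1 m2 x + Deg E m1 m2 y) \<le> B x y" "B x y \<le> 0"
proof -
  have eq: "B x y + (\<Sum>v\<in>V - {y}. B x v) = - Deg E m1 m2 x"
    using B V finite_V sum.remove[of V y "B x"] by (simp add: plans_def rate_def)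
  have "(\<Sum>v\<in>V - {y}. B x v) \<le> (\<Sum>v\<in>V - {y}. rate y v)"
    using plans_le(2)[OF B V V(1)] by (intro sum_mono) auto
  with eq show "- (Deg E m1 m2 x + Deg E m1 m2 y) \<le> B x y"
    using sum_rate_off_diagonal[OF V(2)] by linarith
  have "0 \<le> (\<Sum>v\<in>V - {y}. B x v)" using B V by (intro sum_nonneg) (auto simp: plans_def)
  with eq show "B x y \<le> 0" using Deg_nonneg[OF V(1)] by linarith
qed

lemma plans_bounded:
  assumes B: "B \<in> plans x y" and V: "x \<in> V" "y \<in> V" "u \<in> V" "v \<in> V"
  shows "\<bar>B u v\<bar> \<le> Deg E m1 m2 x + Deg E m1 m2 y"
proof (cases "u = x \<and> v = y")
  case True
  then show ?thesis using plans_diagonal[OF B V(1,2)] by auto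
next
  case False
  then have "0 \<le> B u v" using B V by (auto simp: plans_def)
  moreover have "B u v \<le> Deg E m1 m2 x + Deg E m1 m2 y"
    using False plans_le[OF B V] rate_le_Deg[of x u] rate_le_Deg[of y v] Deg_nonneg[of x] Deg_nonneg[of y] V
    by (cases "u = x") force+
  ultimately show ?thesis by simp
qed

text \<open>Mass moves only between vertices within one step of \<open>x\<close> and of
  \<open>y\<close>. For an edge \<open>{x, y}\<close>, every distance that enters the cost therefore
  belongs to a pair joined by a path, and is not the uncontrolled value
  \<open>Inf {}\<close>.\<close>

lemma plans_support:
  assumes B: "B \<in> plans x y" and V: "x \<in> V" "y \<in> V" "u \<in> V" "v \<in> V" and nz: "B u v \<noteq> 0"
  shows "u = x \<or> {x, u} \<in> E" "v = y \<or> {y, v} \<in> E"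
proof -
  show "u = x \<or> {x, u} \<in> E"
  proof (rule ccontr)
    assume *: "\<not> ?thesis"
    then have "0 \<le> B u v" using B V by (auto simp: plans_def)
    moreover have "B u v \<le> 0" using * plans_le(1)[OF B V] by (auto simp: rate_def)
    ultimately show False using nz by simp
  qed
  show "v = y \<or> {y, v} \<in> E"
  proof (rule ccontr)
    assume *: "\<not> ?thesis"
    then have "0 \<le> B u v" using B V by (auto simp: plans_def)
    moreover have "B u v \<le> 0" using * plans_le(2)[OF B V] by (auto simp: rate_def)
    ultimately show False using nz by simp
  qed
qed

lemma cost_bounded:
  assumes "B \<in> plans x y" "x \<in> V" "y \<in> V"
  shows "\<bar>cost d B\<bar> \<le> (Deg E m1 m2 x + Deg E m1 m2 y) * (\<Sum>u\<in>V. \<Sum>v\<in>V. \<bar>d u v\<bar>)"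
proof -
  have "\<bar>cost d B\<bar> \<le> (\<Sum>u\<in>V. \<Sum>v\<in>V. \<bar>d u v * B u v\<bar>)"
    unfolding cost_def by (rule order_trans[OF sum_abs sum_mono[OF sum_abs]])
  also have "\<dots> \<le> (\<Sum>u\<in>V. \<Sum>v\<in>V. (Deg E m1 m2 x + Deg E m1 m2 y) * \<bar>d u v\<bar>)"
    using plans_bounded[OF assms]
    by (intro sum_mono) (simp add: abs_mult mult.commute[of "\<bar>d _ _\<bar>"] mult_right_mono)
  finally show ?thesis by (simp add: sum_distrib_left)
qed

lemma bdd_below_cost:
  assumes "x \<in> V" "y \<in> V"
  shows "bdd_below (cost d ` plans x y)"
proof (rule bdd_belowI2)
  fix B assume "B \<in> plans x y"
  from cost_bounded[OF this assms, of d]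
  show "- ((Deg E m1 m2 x + Deg E m1 m2 y) * (\<Sum>u\<in>V. \<Sum>v\<in>V. \<bar>d u v\<bar>)) \<le> cost d B"
    by linarith
qed

section \<open>Symmetry and bounds of the drift\<close>

text \<open>Transposing a plan swaps its marginals and preserves the cost of a symmetric
  \<open>d\<close>.\<close>

lemma drift_commute:
  assumes "\<And>u v. d u v = d v u"
  shows "drift d x y = drift d y x"
proof -
  have cost: "cost d B = cost d (\<lambda>u v. B v u)" for B
    unfolding cost_def by (subst sum.swap) (intro sum.cong refl arg_cong2[of _ _ _ _ times] assms)
  have "cost d ` plans a b \<subseteq> cost d ` plans b a" for a b
  proof (rule image_subsetI)
    fix B assume "B \<in> plans a b"
    from image_eqI[where f = "cost d", OF cost plans_transpose[OF this]]
    show "cost d B \<in> cost d ` plans b a" .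
  qed
  then show ?thesis unfolding drift_def by (intro arg_cong[of _ _ Inf] subset_antisym)
qed

lemma drift_lipschitz:
  assumes x: "x \<in> V" and y: "y \<in> V"
  shows "\<bar>drift d x y - drift d' x y\<bar> \<le>
    (Deg E m1 m2 x + Deg E m1 m2 y) * (\<Sum>u\<in>V. \<Sum>v\<in>V. \<bar>d u v - d' u v\<bar>)" (is "_ \<le> ?M d d'")
proof -
  have *: "drift a x y - ?M a b \<le> drift b x y" for a b
    unfolding drift_def[of b]
  proof (rule cINF_greatest[OF plans_nonempty[OF x y]])
    fix B assume B: "B \<in> plans x y"
    have "drift a x y \<le> cost a B"
      unfolding drift_def using B bdd_below_cost[OF x y] by (intro cINF_lower)
    moreover have "cost a B - cost b B = cost (\<lambda>u v. a u v - b u v) B"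
      by (simp add: cost_def sum_subtractf left_diff_distrib)
    moreover have "\<bar>cost (\<lambda>u v. a u v - b u v) B\<bar> \<le> ?M a b" using cost_bounded[OF B x y] .
    ultimately show "drift a x y - ?M a b \<le> cost b B" by linarith
  qed
  show ?thesis using *[of d d'] *[of d' d] by (simp add: abs_le_iff abs_minus_commute)
qed

text \<open>The upper bound \<open>\<kappa>(x, y) \<le> Deg x + Deg y\<close>: it is what keeps the weights positive.\<close>

lemma drift_ge:
  assumes edge: "{x, y} \<in> E" and nonneg: "\<forall>e\<in>E. 0 \<le> \<omega> e"
  shows "- (Deg E m1 m2 x + Deg E m1 m2 y) * wdist E \<omega> x y \<le> drift (wdist E \<omega>) x y"
proof -
  note V = edgeD[OF edge]
  show ?thesis
    unfolding drift_def
  proof (rule cINF_greatest[OF plans_nonempty[OF V(1,2)]])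
    fix B assume B: "B \<in> plans x y"
    have d: "0 \<le> wdist E \<omega> x y"
      using edge nonneg by (intro wdist_nonneg[of E x y "[x, y]"]) (auto simp: path_between_def)
    have summand: "0 \<le> wdist E \<omega> u v * B u v" if uv: "u \<in> V" "v \<in> V" "(u, v) \<noteq> (x, y)" for u v
    proof (cases "B u v = 0")
      case False
      \<comment> \<open>The path from \<open>u\<close> over \<open>x\<close> and \<open>y\<close> to
        \<open>v\<close>, where an end that coincides with \<open>x\<close> or \<open>y\<close> is
        not repeated.\<close>
      have "path_between E u v ((if u = x then [] else [u]) @ [x, y] @ (if v = y then [] else [v]))"
        using plans_support[OF B V(1,2) uv(1,2) False] edge
        by (auto simp: path_between_def insert_commute)
      then have "0 \<le> wdist E \<omega> u v" using nonneg by (rule wdist_nonneg)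
      moreover have "0 \<le> B u v" using B uv by (simp add: plans_def)
      ultimately show ?thesis by simp
    qed simp
    have "wdist E \<omega> x y * B x y \<le> (\<Sum>v\<in>V. wdist E \<omega> x v * B x v)"
    proof -
      have "0 \<le> (\<Sum>v\<in>V - {y}. wdist E \<omega> x v * B x v)"
        using summand V(1) by (intro sum_nonneg) auto
      then show ?thesis using sum.remove[OF finite_V V(2), of "\<lambda>v. wdist E \<omega> x v * B x v"] by simp
    qed
    also have "\<dots> \<le> cost (wdist E \<omega>) B"
    proof -
      have "0 \<le> (\<Sum>u\<in>V - {x}. \<Sum>v\<in>V. wdist E \<omega> u v * B u v)"
        using summand by (intro sum_nonneg) auto
      then show ?thesis
        using sum.remove[OF finite_V V(1), of "\<lambda>u. \<Sum>v\<in>V. wdist E \<omega> u v * B u v"] by (simp add: cost_def)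
    qed
    finally show "- (Deg E m1 m2 x + Deg E m1 m2 y) * wdist E \<omega> x y \<le> cost (wdist E \<omega>) B"
      using mult_right_mono[OF plans_diagonal(1)[OF B V(1,2)] d] by (simp add: mult.commute)
  qed
qed

text \<open>The map \<open>P\<close> carries plans onto couplings and changes the cost by an affine
  map, so the infima correspond. The upper bound on \<epsilon> keeps the entry
  \<open>1 + \<epsilon> * B x y\<close> nonnegative.\<close>

lemma wasserstein_kernel:
  assumes V: "x \<in> V" "y \<in> V" and \<epsilon>: "0 < \<epsilon>" "\<epsilon> * (Deg E m1 m2 x + Deg E m1 m2 y) \<le> 1"
  shows "wasserstein V d (kernel E m1 m2 \<epsilon> x) (kernel E m1 m2 \<epsilon> y) = d x y + \<epsilon> * drift d x y"
proof -
  define \<delta> where "\<delta> u v = (if u = x \<and> v = y then 1 else 0 :: real)" for u v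
  define P where "P B u v = \<delta> u v + \<epsilon> * B u v" for B u v
  have \<delta>: "(\<Sum>v\<in>V. \<delta> u v) = (if u = x then 1 else 0)" "(\<Sum>u\<in>V. \<delta> u v) = (if v = y then 1 else 0)" for u v
  proof -
    have "(\<Sum>v\<in>V. \<delta> u v) = (\<Sum>v\<in>V. if v = y then (if u = x then 1 else 0) else 0)"
      by (rule sum.cong) (auto simp: \<delta>_def)
    then show "(\<Sum>v\<in>V. \<delta> u v) = (if u = x then 1 else 0)" using V finite_V by simp
    have "(\<Sum>u\<in>V. \<delta> u v) = (\<Sum>u\<in>V. if u = x then (if v = y then 1 else 0) else 0)"
      by (rule sum.cong) (auto simp: \<delta>_def)
    then show "(\<Sum>u\<in>V. \<delta> u v) = (if v = y then 1 else 0)" using V finite_V by simp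
  qed
  have marg: "(\<Sum>v\<in>V. P B u v) = (if u = x then 1 else 0) + \<epsilon> * (\<Sum>v\<in>V. B u v)"
    "(\<Sum>u\<in>V. P B u v) = (if v = y then 1 else 0) + \<epsilon> * (\<Sum>u\<in>V. B u v)" for B u v
    by (simp_all add: P_def sum.distrib \<delta> sum_distrib_left)
  have iff: "coupling V (kernel E m1 m2 \<epsilon> x) (kernel E m1 m2 \<epsilon> y) (P B) \<longleftrightarrow> B \<in> plans x y" for B
  proof -
    \<comment> \<open>Off \<open>(x, y)\<close> the signs agree because \<epsilon> is positive. At
      \<open>(x, y)\<close> the lower bound of \<open>plans_diagonal\<close> is needed, which uses
      the marginals as well; hence the extra assumption.\<close>
    have "(\<forall>u\<in>V. \<forall>v\<in>V. 0 \<le> P B u v) \<longleftrightarrow> (\<forall>u\<in>V. \<forall>v\<in>V. (u, v) \<noteq> (x, y) \<longrightarrow> 0 \<le> B u v)"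
      if "B \<in> plans x y \<or> (\<forall>u\<in>V. \<forall>v\<in>V. 0 \<le> P B u v)"
    proof
      assume *: "\<forall>u\<in>V. \<forall>v\<in>V. 0 \<le> P B u v"
      show "\<forall>u\<in>V. \<forall>v\<in>V. (u, v) \<noteq> (x, y) \<longrightarrow> 0 \<le> B u v"
      proof (intro ballI impI)
        fix u v assume "u \<in> V" "v \<in> V" "(u, v) \<noteq> (x, y)"
        then have "0 \<le> \<epsilon> * B u v" using *[rule_format, of u v] by (auto simp: P_def \<delta>_def)
        then show "0 \<le> B u v" using \<epsilon>(1) by (simp add: zero_le_mult_iff)
      qed
    next
      assume *: "\<forall>u\<in>V. \<forall>v\<in>V. (u, v) \<noteq> (x, y) \<longrightarrow> 0 \<le> B u v"
      show "\<forall>u\<in>V. \<forall>v\<in>V. 0 \<le> P B u v"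
      proof (cases "B \<in> plans x y")
        case True
        have "- 1 \<le> \<epsilon> * B x y"
          using mult_left_mono[OF plans_diagonal(1)[OF True V], of \<epsilon>] \<epsilon>
          unfolding mult_minus_right by linarith
        then show ?thesis using * \<epsilon>(1) by (auto simp: P_def \<delta>_def)
      qed (use that in blast)
    qed
    then show ?thesis
      using \<epsilon>(1) unfolding coupling_def marg kernel_eq plans_def by auto
  qed
  have cost: "cost d (P B) = d x y + \<epsilon> * cost d B" for B
  proof -
    have "(\<Sum>u\<in>V. \<Sum>v\<in>V. d u v * \<delta> u v) = (\<Sum>u\<in>V. if u = x then d x y else 0)"
    proof (rule sum.cong[OF refl])
      fix u
      have "(\<Sum>v\<in>V. d u v * \<delta> u v) = (\<Sum>v\<in>V. if v = y then (if u = x then d x y else 0) else 0)"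
        by (rule sum.cong) (auto simp: \<delta>_def)
      then show "(\<Sum>v\<in>V. d u v * \<delta> u v) = (if u = x then d x y else 0)"
        using V finite_V by simp
    qed
    also have "\<dots> = d x y" using V finite_V by simp
    finally show ?thesis
      by (simp add: cost_def P_def distrib_left sum.distrib sum_distrib_left algebra_simps)
  qed
  have "{A. coupling V (kernel E m1 m2 \<epsilon> x) (kernel E m1 m2 \<epsilon> y) A} = P ` plans x y"
  proof (intro subset_antisym subsetI)
    fix A assume A: "A \<in> {A. coupling V (kernel E m1 m2 \<epsilon> x) (kernel E m1 m2 \<epsilon> y) A}"
    \<comment> \<open>The inverse of \<open>P\<close>: every coupling arises from a plan.\<close>
    define B where "B u v = (A u v - \<delta> u v) / \<epsilon>" for u v
    have "A = P B" using \<epsilon>(1) by (simp add: P_def B_def fun_eq_iff)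
    then show "A \<in> P ` plans x y" using A iff[of B] by simp
  qed (use iff in auto)
  then have "{cost d A | A. coupling V (kernel E m1 m2 \<epsilon> x) (kernel E m1 m2 \<epsilon> y) A}
      = (\<lambda>s. d x y + \<epsilon> * s) ` cost d ` plans x y"
    by (simp only: setcompr_eq_image image_image cost)
  then show ?thesis
    unfolding wasserstein_def cost_def[symmetric] drift_def
    using Inf_affine_image[OF _ bdd_below_cost[OF V]] plans_nonempty[OF V] \<epsilon>(1) by simp
qed

text \<open>As \<open>wasserstein_kernel\<close> is an exact identity, the quotient is constant for
  small \<epsilon>, so the limit exists and is that constant.\<close>

lemma curvature_eq:
  assumes V: "x \<in> V" "y \<in> V" and d: "wdist E \<omega> x y \<noteq> 0"
  shows "curvature V E m1 m2 \<omega> x y = - drift (wdist E \<omega>) x y / wdist E \<omega> x y"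
proof -
  define M where "M = Deg E m1 m2 x + Deg E m1 m2 y"
  have M: "0 \<le> M" using Deg_nonneg V by (simp add: M_def)
  \<comment> \<open>With \<open>M\<close> instead of \<open>M + 1\<close> the threshold would be
    \<open>1 / 0 = 0\<close> when both degrees vanish.\<close>
  have "\<forall>\<^sub>F \<epsilon> in at_right 0. 0 < \<epsilon> \<and> \<epsilon> < 1 / (M + 1)"
    using M by (intro eventually_conj eventually_at_right_less eventually_at_right_real[THEN eventually_mono]) auto
  then have "\<forall>\<^sub>F \<epsilon> in at_right 0. 1 / \<epsilon> * (1 - wasserstein V (wdist E \<omega>) (kernel E m1 m2 \<epsilon> x)
      (kernel E m1 m2 \<epsilon> y) / wdist E \<omega> x y) = - drift (wdist E \<omega>) x y / wdist E \<omega> x y"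
  proof eventually_elim
    case (elim \<epsilon>)
    then have "\<epsilon> * (M + 1) < 1" using M by (simp add: pos_less_divide_eq)
    then have "\<epsilon> * M \<le> 1" using elim by (simp add: algebra_simps)
    then have "wasserstein V (wdist E \<omega>) (kernel E m1 m2 \<epsilon> x) (kernel E m1 m2 \<epsilon> y)
        = wdist E \<omega> x y + \<epsilon> * drift (wdist E \<omega>) x y"
      using elim by (intro wasserstein_kernel V) (auto simp: M_def)
    then show ?case using elim d by (simp add: field_simps)
  qed
  then show ?thesis
    unfolding curvature_def by (intro tendsto_Lim) (auto intro: tendsto_eventually)
qed

end

section \<open>The flow between surgeries\<close>

context weighted_graph
begin

lemma subgraph: "E' \<subseteq> E \<Longrightarrow> weighted_graph V E' m1 m2"
  using finite_V graph m1_pos m2_pos by unfold_locales (auto simp: simple_graph_def)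

text \<open>
  The vector field \<open>-\<kappa>\<^sub>\<omega>(e) \<omega>(e)\<close> of the flow on the non-degenerate positive weights; reading the
  distance off \<open>\<bar>\<omega>\<bar>\<close> extends it to a globally Lipschitz field on all of \<open>\<real>\<^sup>E\<close>.
\<close>

definition field :: "('a set \<Rightarrow> real) \<Rightarrow> 'a set \<Rightarrow> real" where
  "field \<omega> e = (case SOME (x, y). e = {x, y} of (x, y) \<Rightarrow> drift (wdist E (\<lambda>e. \<bar>\<omega> e\<bar>)) x y)"

text \<open>\<open>SOME\<close> picks one of the two orientations of the edge; by symmetry of the
  drift both give the same value.\<close>

lemma field_edge: "field \<omega> {x, y} = drift (wdist E (\<lambda>e. \<bar>\<omega> e\<bar>)) x y"
proof -
  obtain a b where ab: "(SOME (a, b). {x, y} = {a, b}) = (a, b)" by fastforce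
  have "{x, y} = {a, b}" using someI[of "\<lambda>(a, b). {x, y} = {a, b}" "(x, y)"] by (simp add: ab)
  then have "a = x \<and> b = y \<or> a = y \<and> b = x" by (auto simp: doubleton_eq_iff)
  then show ?thesis
    using drift_commute[of "wdist E (\<lambda>e. \<bar>\<omega> e\<bar>)", OF wdist_commute] by (auto simp: field_def ab)
qed

text \<open>Twice the sum of all degrees bounds the degrees of two endpoints; one
  \<open>card V\<close> is the Lipschitz constant of the distance, the other two come from summing
  over pairs of vertices.\<close>

definition lip :: real where
  "lip = 2 * (\<Sum>x\<in>V. Deg E m1 m2 x) * (card V * (card V * card V))"

lemma lip_nonneg: "0 \<le> lip"
  using Deg_nonneg by (simp add: lip_def sum_nonneg)

lemma field_lipschitz:
  assumes "e \<in> E"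
  shows "\<bar>field \<omega> e - field \<omega>' e\<bar> \<le> lip * (\<Sum>e\<in>E. \<bar>\<omega> e - \<omega>' e\<bar>)"
proof -
  obtain x y where e: "e = {x, y}" and V: "x \<in> V" "y \<in> V"
    using simple_graph_edgeE[OF graph assms] by metis
  let ?d = "wdist E (\<lambda>e. \<bar>\<omega> e\<bar>)" and ?d' = "wdist E (\<lambda>e. \<bar>\<omega>' e\<bar>)"
  define D where "D = (\<Sum>e\<in>E. \<bar>\<omega> e - \<omega>' e\<bar>)"
  have D: "0 \<le> D" by (simp add: D_def sum_nonneg)
  have "\<bar>?d u v - ?d' u v\<bar> \<le> card V * D" if "u \<in> V" for u v
  proof -
    have "(\<Sum>e\<in>E. \<bar>\<bar>\<omega> e\<bar> - \<bar>\<omega>' e\<bar>\<bar>) \<le> D" unfolding D_def by (intro sum_mono) linarith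
    then have "card V * (\<Sum>e\<in>E. \<bar>\<bar>\<omega> e\<bar> - \<bar>\<omega>' e\<bar>\<bar>) \<le> card V * D" by (intro mult_left_mono) auto
    moreover have "\<bar>?d u v - ?d' u v\<bar> \<le> card V * (\<Sum>e\<in>E. \<bar>\<bar>\<omega> e\<bar> - \<bar>\<omega>' e\<bar>\<bar>)"
      using that by (intro wdist_lipschitz_le finite_V graph) auto
    ultimately show ?thesis by linarith
  qed
  then have "(\<Sum>u\<in>V. \<Sum>v\<in>V. \<bar>?d u v - ?d' u v\<bar>) \<le> (\<Sum>u\<in>V. \<Sum>v\<in>V. card V * D)"
    by (intro sum_mono)
  also have "\<dots> = card V * (card V * card V) * D" by simp
  finally have dist: "(\<Sum>u\<in>V. \<Sum>v\<in>V. \<bar>?d u v - ?d' u v\<bar>) \<le> card V * (card V * card V) * D" .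
  have Deg: "Deg E m1 m2 z \<le> (\<Sum>x\<in>V. Deg E m1 m2 x)" if "z \<in> V" for z
    using that finite_V Deg_nonneg by (intro member_le_sum) auto
  have "\<bar>field \<omega> e - field \<omega>' e\<bar> \<le> (Deg E m1 m2 x + Deg E m1 m2 y) * (\<Sum>u\<in>V. \<Sum>v\<in>V. \<bar>?d u v - ?d' u v\<bar>)"
    unfolding e field_edge using V by (rule drift_lipschitz)
  also have "\<dots> \<le> 2 * (\<Sum>x\<in>V. Deg E m1 m2 x) * (card V * (card V * card V) * D)"
    using Deg[OF V(1)] Deg[OF V(2)] Deg_nonneg dist
    by (intro mult_mono) (auto intro!: sum_nonneg mult_nonneg_nonneg)
  finally show ?thesis by (simp add: lip_def D_def mult.assoc)
qed

text \<open>The distance is at most \<open>\<bar>\<omega> e\<bar>\<close> even at degenerate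
  weights. So one \<open>M\<close> serves all weights, and solutions of the extended ODE stay
  positive also after an edge has become degenerate.\<close>

lemma field_ge:
  assumes "e \<in> E"
  obtains M where "\<And>\<omega>. - M * \<bar>\<omega> e\<bar> \<le> field \<omega> e"
proof -
  obtain x y where e: "e = {x, y}" and V: "x \<in> V" "y \<in> V"
    using simple_graph_edgeE[OF graph assms] by metis
  define M where "M = Deg E m1 m2 x + Deg E m1 m2 y"
  show ?thesis
  proof
    fix \<omega>
    have "wdist E (\<lambda>e. \<bar>\<omega> e\<bar>) x y \<le> \<bar>\<omega> e\<bar>" using assms e wdist_edge_le[of x y E "\<lambda>e. \<bar>\<omega> e\<bar>"] by simp
    then have "M * wdist E (\<lambda>e. \<bar>\<omega> e\<bar>) x y \<le> M * \<bar>\<omega> e\<bar>"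
      using Deg_nonneg V by (intro mult_left_mono) (auto simp: M_def)
    moreover have "- M * wdist E (\<lambda>e. \<bar>\<omega> e\<bar>) x y \<le> field \<omega> e"
      unfolding e field_edge M_def using assms e by (intro drift_ge) auto
    ultimately show "- M * \<bar>\<omega> e\<bar> \<le> field \<omega> e" by simp
  qed
qed

text \<open>Non-degeneracy makes the distance equal to \<open>\<omega> {x, y}\<close>, which cancels
  the denominator in \<open>curvature_eq\<close>.\<close>

lemma curvature_field:
  assumes pos: "\<forall>e\<in>E. 0 < \<omega> e" and nd: "degenerate_edges E \<omega> = {}" and e: "{x, y} \<in> E"
  shows "- curvature V E m1 m2 \<omega> x y * \<omega> {x, y} = field \<omega> {x, y}"
proof -
  have "wdist E \<omega> x y = \<omega> {x, y}" using e pos nd by (intro wdist_edge) (auto simp: less_imp_le)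
  moreover have "0 < \<omega> {x, y}" using pos e by blast
  moreover have "wdist E (\<lambda>e. \<bar>\<omega> e\<bar>) = wdist E \<omega>"
    using pos by (intro ext wdist_cong) (auto simp: abs_of_pos)
  ultimately show ?thesis using curvature_eq[OF edgeD(1)[OF e] edgeD(2)[OF e], of \<omega>] by (simp add: field_edge)
qed

lemma continuous_on_field:
  assumes "\<And>e. e \<in> E \<Longrightarrow> continuous_on I (\<lambda>t. \<omega> t e)" and e: "e \<in> E"
  shows "continuous_on I (\<lambda>t. field (\<omega> t) e)"
  unfolding continuous_on_def
proof
  fix t assume t: "t \<in> I"
  have "((\<lambda>s. lip * (\<Sum>j\<in>E. \<bar>\<omega> s j - \<omega> t j\<bar>)) \<longlongrightarrow> lip * (\<Sum>j\<in>E. \<bar>\<omega> t j - \<omega> t j\<bar>)) (at t within I)"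
    using assms(1) t by (intro tendsto_intros) (auto simp: continuous_on_def)
  then have "((\<lambda>s. lip * (\<Sum>j\<in>E. \<bar>\<omega> s j - \<omega> t j\<bar>)) \<longlongrightarrow> 0) (at t within I)" by simp
  then have "((\<lambda>s. field (\<omega> s) e - field (\<omega> t) e) \<longlongrightarrow> 0) (at t within I)"
    by (rule Lim_null_comparison[rotated]) (simp add: field_lipschitz[OF e])
  then show "((\<lambda>s. field (\<omega> s) e) \<longlongrightarrow> field (\<omega> t) e) (at t within I)" by (rule Lim_null[THEN iffD2])
qed

text \<open>Replaces the curvature equation by the ODE of \<open>field\<close>. Continuity of the
  derivative is inherited from \<open>field\<close>, which is continuous along continuous
  curves.\<close>

lemma solves_flow_on_iff:
  assumes nd: "\<And>t. t \<in> I \<Longrightarrow> degenerate_edges E (\<omega> t) = {}"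
  shows "solves_flow_on V E m1 m2 I \<omega> \<longleftrightarrow>
    (\<forall>e\<in>E. \<forall>t\<in>I. 0 < \<omega> t e \<and> ((\<lambda>s. \<omega> s e) has_real_derivative field (\<omega> t) e) (at t within I))"
    (is "?L \<longleftrightarrow> ?R")
proof
  assume L: ?L
  show ?R
  proof (intro ballI conjI)
    fix e t assume e: "e \<in> E" and t: "t \<in> I"
    show "0 < \<omega> t e" using L e t by (simp add: solves_flow_on_def)
    obtain x y where xy: "e = {x, y}" using simple_graph_edgeE[OF graph e] by metis
    have "- curvature V E m1 m2 (\<omega> t) x y * \<omega> t {x, y} = field (\<omega> t) {x, y}"
      using L nd[OF t] e t xy by (intro curvature_field) (auto simp: solves_flow_on_def)
    then show "((\<lambda>s. \<omega> s e) has_real_derivative field (\<omega> t) e) (at t within I)"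
      using L e t xy unfolding solves_flow_on_def by metis
  qed
next
  assume R: ?R
  show ?L
    unfolding solves_flow_on_def
  proof (intro ballI conjI exI[of _ "\<lambda>t. field (\<omega> t) e" for e] allI impI)
    fix e assume e: "e \<in> E"
    show "continuous_on I (\<lambda>t. field (\<omega> t) e)"
      using R by (intro continuous_on_field e DERIV_continuous_on[where D = "\<lambda>t. field (\<omega> t) _"]) auto
    fix t assume t: "t \<in> I"
    show "0 < \<omega> t e" "((\<lambda>s. \<omega> s e) has_real_derivative field (\<omega> t) e) (at t within I)"
      using R e t by auto
    fix x y assume "e = {x, y}"
    then show "field (\<omega> t) e = - curvature V E m1 m2 (\<omega> t) x y * \<omega> t e"
      using R nd[OF t] e t curvature_field[of "\<omega> t" x y] by auto
  qed
qed

text \<open>The solution may run through degenerate weights, where it is no longer the curvature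
  flow; only its part before the first such time will be kept.\<close>

lemma global_flow:
  assumes "\<forall>e\<in>E. 0 < \<omega>0 e"
  obtains \<omega> :: "real \<Rightarrow> 'a set \<Rightarrow> real" where "\<And>e. e \<in> E \<Longrightarrow> \<omega> T e = \<omega>0 e"
    and "\<And>e t. e \<in> E \<Longrightarrow> T \<le> t \<Longrightarrow> ((\<lambda>t. \<omega> t e) has_real_derivative field (\<omega> t) e) (at t within {T..})"
    and "\<And>e t. e \<in> E \<Longrightarrow> T \<le> t \<Longrightarrow> 0 < \<omega> t e"
proof -
  obtain \<omega> where \<omega>: "\<And>e. e \<in> E \<Longrightarrow> \<omega> T e = \<omega>0 e"
    "\<And>e t. e \<in> E \<Longrightarrow> T \<le> t \<Longrightarrow> ((\<lambda>t. \<omega> t e) has_real_derivative field (\<omega> t) e) (at t within {T..})"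
  proof (rule finite_system_global_solution[OF finite_E lip_nonneg field_lipschitz, where T = T and ?x0.0 = \<omega>0])
    fix x :: "real \<Rightarrow> 'a set \<Rightarrow> real"
    assume "\<And>e. e \<in> E \<Longrightarrow> x T e = \<omega>0 e"
      and "\<And>e t. e \<in> E \<Longrightarrow> T \<le> t \<Longrightarrow> ((\<lambda>t. x t e) has_real_derivative field (x t) e) (at t within {T..})"
    then show thesis by (rule that)
  qed
  moreover have "0 < \<omega> t e" if e: "e \<in> E" and "T \<le> t" for e t
  proof -
    obtain M where M: "- M * \<bar>\<alpha> e\<bar> \<le> field \<alpha> e" for \<alpha> using field_ge[OF e] by metis
    have "0 < \<omega> T e" using \<omega>(1) e assms by simp
    from positive_of_DERIV_ge[OF \<omega>(2)[OF e] M this \<open>T \<le> t\<close>] show ?thesis .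
  qed
  ultimately show ?thesis using that by blast
qed

text \<open>Only the detours, of which there are finitely many, can become too short.\<close>

lemma closed_degenerate_times:
  fixes \<omega> :: "real \<Rightarrow> 'a set \<Rightarrow> real"
  assumes cont: "\<And>e. e \<in> E \<Longrightarrow> continuous_on {T..} (\<lambda>t. \<omega> t e)"
    and pos: "\<And>e t. e \<in> E \<Longrightarrow> T \<le> t \<Longrightarrow> 0 < \<omega> t e"
  shows "closed {t \<in> {T..}. degenerate_edges E (\<omega> t) \<noteq> {}}"
proof -
  have "{t \<in> {T..}. degenerate_edges E (\<omega> t) \<noteq> {}} =
    (\<Union>ep\<in>detours E. {t \<in> {T..}. path_weight (\<omega> t) (snd ep) \<le> \<omega> t (fst ep)})"
  proof -
    have "degenerate_edges E (\<omega> t) \<noteq> {} \<longleftrightarrow> (\<exists>ep\<in>detours E. path_weight (\<omega> t) (snd ep) \<le> \<omega> t (fst ep))"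
      if "T \<le> t" for t
      using degenerate_edges_nonempty_iff[of E "\<omega> t"] pos that by (simp add: split_beta)
    then show ?thesis by blast
  qed
  moreover have "closed {t \<in> {T..}. path_weight (\<omega> t) (snd ep) \<le> \<omega> t (fst ep)}" if "ep \<in> detours E" for ep
  proof -
    have "successively (\<lambda>x y. {x, y} \<in> E) (snd ep)" "fst ep \<in> E"
      using that by (auto simp: detours_def path_between_def)
    moreover have "successively (\<lambda>x y. {x, y} \<in> E) p \<Longrightarrow> continuous_on {T..} (\<lambda>t. path_weight (\<omega> t) p)" for p
      by (induction p rule: induct_list012) (auto intro!: continuous_intros cont)
    ultimately show ?thesis
      by (intro continuous_on_closed_Collect_le) (auto intro: cont closed_atLeast)
  qed
  ultimately show ?thesis using finite_detours[OF finite_V graph] by auto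
qed

end

section \<open>Surgery\<close>

lemma solves_flow_on_cong:
  assumes "solves_flow_on V E m1 m2 I \<omega>" "\<And>t. t \<in> I \<Longrightarrow> \<omega> t = \<omega>' t"
  shows "solves_flow_on V E m1 m2 I \<omega>'"
proof -
  have "((\<lambda>s. \<omega>' s e) has_real_derivative D) (at t within I)"
    if "((\<lambda>s. \<omega> s e) has_real_derivative D) (at t within I)" "t \<in> I" for e D t
    using that assms(2) by (intro has_field_derivative_transform_within[OF that(1) zero_less_one]) auto
  then show ?thesis using assms unfolding solves_flow_on_def by metis
qed

text \<open>\<open>flow_solution\<close> with a free starting time and with the initial deletion
  already carried out, so that the flow after a surgery has the same form and induction
  applies.\<close>

definition flow_from ::
    "'a set \<Rightarrow> ('a \<Rightarrow> real) \<Rightarrow> ('a set \<Rightarrow> real) \<Rightarrow> real \<Rightarrow> 'a set set \<Rightarrow> ('a set \<Rightarrow> real) \<Rightarrow>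
     nat \<Rightarrow> (nat \<Rightarrow> real) \<Rightarrow> (nat \<Rightarrow> 'a set set) \<Rightarrow> (real \<Rightarrow> 'a set \<Rightarrow> real) \<Rightarrow> bool" where
  "flow_from V m1 m2 T0 E0 \<omega>0 k T Es \<omega> \<longleftrightarrow>
     T 0 = T0 \<and> (\<forall>i<k. T i < T (Suc i)) \<and>
     Es 0 = E0 \<and> (\<forall>e\<in>Es 0. \<omega> T0 e = \<omega>0 e) \<and>
     (\<forall>i\<le>k. solves_flow_on V (Es i) m1 m2 (phase k T i) \<omega> \<and>
       (\<forall>t\<in>phase k T i. degenerate_edges (Es i) (\<omega> t) = {})) \<and>
     (\<forall>i<k. \<exists>\<omega>L.
       (\<forall>e\<in>Es i. 0 < \<omega>L e \<and> ((\<lambda>t. \<omega> t e) \<longlongrightarrow> \<omega>L e) (at_left (T (Suc i)))) \<and>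
       degenerate_edges (Es i) \<omega>L \<noteq> {} \<and>
       Es (Suc i) = Es i - degenerate_edges (Es i) \<omega>L \<and>
       (\<forall>e\<in>Es (Suc i). \<omega> (T (Suc i)) e = \<omega>L e))"

lemma flow_solution_iff:
  "flow_solution V E m1 m2 \<omega>0 k T Es \<omega> \<longleftrightarrow>
    flow_from V m1 m2 0 (E - degenerate_edges E \<omega>0) \<omega>0 k T Es \<omega>"
  by (simp add: flow_solution_def flow_from_def)

lemma flow_from_surgery:
  assumes "flow_from V m1 m2 T0 E0 \<omega>0 k T Es \<omega>" "i < k"
  obtains \<omega>L where "\<And>e. e \<in> Es i \<Longrightarrow> 0 < \<omega>L e"
    and "\<And>e. e \<in> Es i \<Longrightarrow> ((\<lambda>t. \<omega> t e) \<longlongrightarrow> \<omega>L e) (at_left (T (Suc i)))"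
    and "degenerate_edges (Es i) \<omega>L \<noteq> {}" "Es (Suc i) = Es i - degenerate_edges (Es i) \<omega>L"
    and "\<And>e. e \<in> Es (Suc i) \<Longrightarrow> \<omega> (T (Suc i)) e = \<omega>L e"
proof -
  have "\<forall>i<k. \<exists>\<omega>L.
       (\<forall>e\<in>Es i. 0 < \<omega>L e \<and> ((\<lambda>t. \<omega> t e) \<longlongrightarrow> \<omega>L e) (at_left (T (Suc i)))) \<and>
       degenerate_edges (Es i) \<omega>L \<noteq> {} \<and>
       Es (Suc i) = Es i - degenerate_edges (Es i) \<omega>L \<and>
       (\<forall>e\<in>Es (Suc i). \<omega> (T (Suc i)) e = \<omega>L e)"
    using assms(1) unfolding flow_from_def by (elim conjE)
  with assms(2) show ?thesis by (elim allE[of _ i] impE exE conjE) (auto intro: that)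
qed

lemma flow_from_T_le:
  assumes "flow_from V m1 m2 T0 E0 \<omega>0 k T Es \<omega>" "i \<le> k"
  shows "T0 \<le> T i"
  using assms(2)
proof (induction i)
  case (Suc i)
  then have "T i < T (Suc i)" using assms(1) by (simp add: flow_from_def)
  then show ?case using Suc by simp
qed (use assms(1) in \<open>simp add: flow_from_def\<close>)

text \<open>Puts one phase in front of a flow starting at \<open>T1\<close>; \<open>case_nat\<close>
  shifts the indices of the latter by one. At \<open>T1\<close> itself the later flow counts, as
  phases are half-open.\<close>

lemma flow_from_Cons:
  assumes flow: "flow_from V m1 m2 T1 E1 \<omega>1 k T Es \<omega>" and T: "T0 < T1"
    and sol: "solves_flow_on V E0 m1 m2 {T0..<T1} \<alpha>" and init: "\<forall>e\<in>E0. \<alpha> T0 e = \<omega>0 e"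
    and nd: "\<forall>t\<in>{T0..<T1}. degenerate_edges E0 (\<alpha> t) = {}"
    and lim: "\<forall>e\<in>E0. 0 < \<omega>1 e \<and> ((\<lambda>t. \<alpha> t e) \<longlongrightarrow> \<omega>1 e) (at_left T1)"
    and deg: "degenerate_edges E0 \<omega>1 \<noteq> {}" and E1: "E1 = E0 - degenerate_edges E0 \<omega>1"
  shows "flow_from V m1 m2 T0 E0 \<omega>0 (Suc k) (case_nat T0 T) (case_nat E0 Es) (\<lambda>t. if t < T1 then \<alpha> t else \<omega> t)"
    (is "flow_from _ _ _ _ _ _ _ ?T ?Es ?\<omega>")
proof -
  note flow' = flow[unfolded flow_from_def]
  have T_le: "T1 \<le> T i" if "i \<le> k" for i using flow_from_T_le[OF flow that] .
  have phase0: "phase (Suc k) ?T 0 = {T0..<T1}" using flow' by (simp add: phase_def)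
  have phaseS: "phase (Suc k) ?T (Suc i) = phase k T i" for i by (simp add: phase_def)
  have later: "T1 \<le> t" if "t \<in> phase k T i" "i \<le> k" for t i
    using that T_le[of i] by (auto simp: phase_def split: if_splits)
  show ?thesis
    unfolding flow_from_def
  proof (intro conjI allI impI)
    show "?T 0 = T0" "?Es 0 = E0" "\<forall>e\<in>?Es 0. ?\<omega> T0 e = \<omega>0 e" using T init by auto
    show "?T i < ?T (Suc i)" if "i < Suc k" for i
      using that flow' T by (cases i) auto
  next
    fix i assume i: "i \<le> Suc k"
    have "solves_flow_on V (?Es i) m1 m2 (phase (Suc k) ?T i) ?\<omega> \<and>
      (\<forall>t\<in>phase (Suc k) ?T i. degenerate_edges (?Es i) (?\<omega> t) = {})"
    proof (cases i)
      case 0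
      then show ?thesis
        unfolding 0 phase0 using nd by (auto intro: solves_flow_on_cong[OF sol])
    next
      case (Suc j)
      then have j: "j \<le> k" using i by simp
      then have "solves_flow_on V (Es j) m1 m2 (phase k T j) \<omega>"
        "\<forall>t\<in>phase k T j. degenerate_edges (Es j) (\<omega> t) = {}" using flow' by auto
      then show ?thesis
        unfolding Suc phaseS using later[OF _ j] by (force intro: solves_flow_on_cong)
    qed
    then show "solves_flow_on V (?Es i) m1 m2 (phase (Suc k) ?T i) ?\<omega>"
      "\<forall>t\<in>phase (Suc k) ?T i. degenerate_edges (?Es i) (?\<omega> t) = {}" by blast+
  next
    fix i assume i: "i < Suc k"
    show "\<exists>\<omega>L. (\<forall>e\<in>?Es i. 0 < \<omega>L e \<and> ((\<lambda>t. ?\<omega> t e) \<longlongrightarrow> \<omega>L e) (at_left (?T (Suc i)))) \<and>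
       degenerate_edges (?Es i) \<omega>L \<noteq> {} \<and> ?Es (Suc i) = ?Es i - degenerate_edges (?Es i) \<omega>L \<and>
       (\<forall>e\<in>?Es (Suc i). ?\<omega> (?T (Suc i)) e = \<omega>L e)"
    proof (cases i)
      case 0
      have "((\<lambda>t. ?\<omega> t e) \<longlongrightarrow> \<omega>1 e) (at_left T1)" if "e \<in> E0" for e
      proof (rule Lim_transform_eventually)
        show "((\<lambda>t. \<alpha> t e) \<longlongrightarrow> \<omega>1 e) (at_left T1)" using lim that by blast
        show "\<forall>\<^sub>F t in at_left T1. \<alpha> t e = ?\<omega> t e"
          by (auto simp: eventually_at_filter)
      qed
      then show ?thesis
        using 0 lim deg E1 flow' by (intro exI[of _ \<omega>1]) auto
    next
      case (Suc j)
      then have j: "j < k" using i by simp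
      obtain \<omega>L where \<omega>L: "\<forall>e\<in>Es j. 0 < \<omega>L e \<and> ((\<lambda>t. \<omega> t e) \<longlongrightarrow> \<omega>L e) (at_left (T (Suc j)))"
        "degenerate_edges (Es j) \<omega>L \<noteq> {}" "Es (Suc j) = Es j - degenerate_edges (Es j) \<omega>L"
        "\<forall>e\<in>Es (Suc j). \<omega> (T (Suc j)) e = \<omega>L e" using flow_from_surgery[OF flow j] by metis
      have Tj: "T1 \<le> T j" "T j < T (Suc j)" using T_le[of j] j flow' by auto
      have "((\<lambda>t. ?\<omega> t e) \<longlongrightarrow> \<omega>L e) (at_left (T (Suc j)))" if "e \<in> Es j" for e
      proof (rule Lim_transform_eventually)
        show "((\<lambda>t. \<omega> t e) \<longlongrightarrow> \<omega>L e) (at_left (T (Suc j)))" using \<omega>L that by blast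
        have "\<forall>\<^sub>F t in at_left (T (Suc j)). t \<in> {T j<..<T (Suc j)}"
          using Tj(2) by (rule eventually_at_left_real)
        then show "\<forall>\<^sub>F t in at_left (T (Suc j)). \<omega> t e = ?\<omega> t e"
          by eventually_elim (use Tj in auto)
      qed
      then show ?thesis
        using Suc \<omega>L Tj by (intro exI[of _ \<omega>L]) auto
    qed
  qed
qed

text \<open>Each surgery deletes at least one edge, so the recursion ends after finitely many phases.\<close>

lemma flow_from_exists:
  assumes "weighted_graph V E m1 m2" "\<forall>e\<in>E. 0 < \<omega>0 e" "degenerate_edges E \<omega>0 = {}"
  shows "\<exists>k T Es \<omega>. flow_from V m1 m2 T0 E \<omega>0 k T Es \<omega>"
  using assms
proof (induction "card E" arbitrary: E \<omega>0 T0 rule: less_induct)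
  case less
  interpret weighted_graph V E m1 m2 by (rule less.prems)
  obtain \<alpha> :: "real \<Rightarrow> 'a set \<Rightarrow> real" where \<alpha>: "\<And>e. e \<in> E \<Longrightarrow> \<alpha> T0 e = \<omega>0 e"
    "\<And>e t. e \<in> E \<Longrightarrow> T0 \<le> t \<Longrightarrow> ((\<lambda>t. \<alpha> t e) has_real_derivative field (\<alpha> t) e) (at t within {T0..})"
    "\<And>e t. e \<in> E \<Longrightarrow> T0 \<le> t \<Longrightarrow> 0 < \<alpha> t e"
    using global_flow[OF less.prems(2), of T0] by blast
  have cont: "continuous_on {T0..} (\<lambda>t. \<alpha> t e)" if "e \<in> E" for e
    using \<alpha>(2)[OF that] by (intro DERIV_continuous_on[where D = "\<lambda>t. field (\<alpha> t) e"]) auto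
  have sol: "solves_flow_on V E m1 m2 I \<alpha>"
    if "I \<subseteq> {T0..}" "\<And>t. t \<in> I \<Longrightarrow> degenerate_edges E (\<alpha> t) = {}" for I
    using has_field_derivative_subset[OF \<alpha>(2) that(1)] that \<alpha>(3)
    by (subst solves_flow_on_iff) (blast | force)+
  define S where "S = {t \<in> {T0..}. degenerate_edges E (\<alpha> t) \<noteq> {}}"
  show ?case
  proof (cases "S = {}")
    case True
    \<comment> \<open>No edge ever becomes degenerate: a single unbounded phase.\<close>
    have "flow_from V m1 m2 T0 E \<omega>0 0 (\<lambda>_. T0) (\<lambda>_. E) \<alpha>"
      using \<alpha>(1) True sol[of "{T0..}"] by (auto simp: flow_from_def phase_def S_def)
    then show ?thesis by blast
  next
    case False
    \<comment> \<open>The first surgery time. Closedness of \<open>S\<close> puts \<open>T1\<close>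
      into \<open>S\<close>, so some edge is degenerate at \<open>T1\<close> and the edge set really
      shrinks.\<close>
    define T1 where "T1 = Inf S"
    have bdd: "bdd_below S" by (intro bdd_belowI[of _ T0]) (auto simp: S_def)
    have "closed S" unfolding S_def using cont \<alpha>(3) by (rule closed_degenerate_times)
    with False bdd have T1: "T1 \<in> S" unfolding T1_def by (intro closed_contains_Inf)
    have "degenerate_edges E (\<alpha> T0) = {}"
      using less.prems(3) degenerate_edges_cong[of E "\<alpha> T0" \<omega>0] \<alpha>(1) by simp
    with T1 have T01: "T0 < T1" unfolding S_def by (cases "T1 = T0") auto
    have nd: "degenerate_edges E (\<alpha> t) = {}" if "t \<in> {T0..<T1}" for t
    proof (rule ccontr)
      assume "degenerate_edges E (\<alpha> t) \<noteq> {}"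
      then have "t \<in> S" using that by (simp add: S_def)
      then have "T1 \<le> t" unfolding T1_def using bdd by (intro cInf_lower)
      then show False using that by simp
    qed
    define E1 where "E1 = E - degenerate_edges E (\<alpha> T1)"
    have deg: "degenerate_edges E (\<alpha> T1) \<noteq> {}" using T1 by (simp add: S_def)
    then have "E1 \<subset> E" using degenerate_edges_subset[of E "\<alpha> T1"] by (auto simp: E1_def)
    then have "card E1 < card E" by (intro psubset_card_mono finite_E)
    moreover have "weighted_graph V E1 m1 m2" using \<open>E1 \<subset> E\<close> by (intro subgraph) auto
    moreover have "\<forall>e\<in>E1. 0 < \<alpha> T1 e" using \<alpha>(3) T01 by (simp add: E1_def)
    moreover have "degenerate_edges E1 (\<alpha> T1) = {}" unfolding E1_def by (rule degenerate_edges_diff)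
    ultimately obtain k T Es \<omega> where flow: "flow_from V m1 m2 T1 E1 (\<alpha> T1) k T Es \<omega>"
      using less.hyps by blast
    have "((\<lambda>t. \<alpha> t e) \<longlongrightarrow> \<alpha> T1 e) (at_left T1)" if "e \<in> E" for e
    proof -
      have "continuous_on {T0..T1} (\<lambda>t. \<alpha> t e)" using cont[OF that] by (rule continuous_on_subset) auto
      then show ?thesis using T01 by (rule continuous_on_Icc_at_leftD)
    qed
    then have "flow_from V m1 m2 T0 E \<omega>0 (Suc k) (case_nat T0 T) (case_nat E Es) (\<lambda>t. if t < T1 then \<alpha> t else \<omega> t)"
      using T01 \<alpha>(1,3) nd deg
      by (intro flow_from_Cons[OF flow T01] sol) (auto simp: E1_def)
    then show ?thesis by blast
  qed
qed

section \<open>Uniqueness of the flow with surgery\<close>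

lemma phase_interval: "t \<in> phase k T i \<Longrightarrow> {T i..t} \<subseteq> phase k T i"
  by (auto simp: phase_def split: if_splits)

lemma flow_from_edges_subset:
  assumes "flow_from V m1 m2 T0 E0 \<omega>0 k T Es \<omega>" "i \<le> k"
  shows "Es i \<subseteq> E0"
  using assms(2)
proof (induction i)
  case (Suc i)
  have "i < k" using Suc.prems by simp
  from flow_from_surgery[OF assms(1) this] have "Es (Suc i) \<subseteq> Es i" by (metis Diff_subset)
  then show ?case using Suc by simp
qed (use assms(1) in \<open>simp add: flow_from_def\<close>)

text \<open>The invariant of the induction over phases. It concerns the start of the phase only; the
  rest follows from uniqueness for the ODE.\<close>

definition agree_at_phase ::
    "(nat \<Rightarrow> real) \<Rightarrow> (nat \<Rightarrow> 'a set set) \<Rightarrow> (real \<Rightarrow> 'a set \<Rightarrow> real) \<Rightarrow>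
     (nat \<Rightarrow> real) \<Rightarrow> (nat \<Rightarrow> 'a set set) \<Rightarrow> (real \<Rightarrow> 'a set \<Rightarrow> real) \<Rightarrow> nat \<Rightarrow> bool" where
  "agree_at_phase T Es \<omega> T' Es' \<omega>' i \<longleftrightarrow> T i = T' i \<and> Es i = Es' i \<and> (\<forall>e\<in>Es i. \<omega> (T i) e = \<omega>' (T i) e)"

lemma agree_at_phase_sym: "agree_at_phase T Es \<omega> T' Es' \<omega>' i \<Longrightarrow> agree_at_phase T' Es' \<omega>' T Es \<omega> i"
  by (auto simp: agree_at_phase_def)

text \<open>On \<open>{T i..t}\<close> both weights solve the same Lipschitz system with the same
  initial values. The ends of the two phases may still differ, so \<open>t\<close> is taken in
  both.\<close>

lemma flow_from_agree_phase:
  assumes graph: "weighted_graph V E0 m1 m2"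
    and flow: "flow_from V m1 m2 T0 E0 \<omega>0 k T Es \<omega>"
    and flow': "flow_from V m1 m2 T0' E0' \<omega>0' k' T' Es' \<omega>'"
    and i: "i \<le> k" "i \<le> k'" and agree: "agree_at_phase T Es \<omega> T' Es' \<omega>' i"
    and t: "t \<in> phase k T i" "t \<in> phase k' T' i" and e: "e \<in> Es i"
  shows "\<omega> t e = \<omega>' t e"
proof -
  interpret weighted_graph V "Es i" m1 m2
    using weighted_graph.subgraph[OF graph flow_from_edges_subset[OF flow i(1)]] .
  have T: "T' i = T i" "Es' i = Es i" "\<And>e. e \<in> Es i \<Longrightarrow> \<omega> (T i) e = \<omega>' (T i) e"
    using agree by (auto simp: agree_at_phase_def)
  have sub: "{T i..t} \<subseteq> phase k T i" "{T i..t} \<subseteq> phase k' T' i"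
    using phase_interval[OF t(1)] phase_interval[OF t(2)] T by auto
  have sol: "solves_flow_on V (Es i) m1 m2 (phase k T i) \<omega>" "\<And>t. t \<in> phase k T i \<Longrightarrow> degenerate_edges (Es i) (\<omega> t) = {}"
    "solves_flow_on V (Es i) m1 m2 (phase k' T' i) \<omega>'" "\<And>t. t \<in> phase k' T' i \<Longrightarrow> degenerate_edges (Es i) (\<omega>' t) = {}"
    using flow flow' i T unfolding flow_from_def by auto
  show ?thesis
  proof (rule finite_system_unique[where A = "Es i" and F = field and x = \<omega> and y = \<omega>' and a = "T i",
        OF finite_E lip_nonneg field_lipschitz])
    show "T i \<le> t" using t(1) by (auto simp: phase_def split: if_splits)
    fix e s assume "e \<in> Es i" and "s \<in> {T i..t}"
    then show "((\<lambda>t. \<omega> t e) has_real_derivative field (\<omega> s) e) (at s within {T i..t})"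
      "((\<lambda>t. \<omega>' t e) has_real_derivative field (\<omega>' s) e) (at s within {T i..t})"
      using sub iffD1[OF solves_flow_on_iff[of "phase k T i" \<omega>, OF sol(2)] sol(1)]
        iffD1[OF solves_flow_on_iff[of "phase k' T' i" \<omega>', OF sol(4)] sol(3)]
      by (blast intro: has_field_derivative_subset)+
  qed (use e T(3) in auto)
qed

text \<open>A solution cannot be continued past the surgery time of another one with the same initial data,
  since it would have a degenerate edge there.\<close>

lemma flow_from_next_time_le:
  assumes graph: "weighted_graph V E0 m1 m2"
    and flow: "flow_from V m1 m2 T0 E0 \<omega>0 k T Es \<omega>"
    and flow': "flow_from V m1 m2 T0' E0' \<omega>0' k' T' Es' \<omega>'"
    and i: "i < k" "i \<le> k'" and agree: "agree_at_phase T Es \<omega> T' Es' \<omega>' i"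
  shows "i < k' \<and> T' (Suc i) \<le> T (Suc i)"
proof (rule ccontr)
  define b where "b = T (Suc i)"
  have T: "T' i = T i" "Es' i = Es i" "T i < b"
    using agree i flow by (auto simp: agree_at_phase_def flow_from_def b_def)
  assume "\<not> ?thesis"
  \<comment> \<open>Either phase \<open>i\<close> of the second flow is its last one, hence
    unbounded, or it ends after \<open>b\<close>; it contains \<open>b\<close> in both
    cases.\<close>
  then have b: "b \<in> phase k' T' i" using T by (auto simp: phase_def b_def)
  obtain \<omega>L where \<omega>L: "\<And>e. e \<in> Es i \<Longrightarrow> ((\<lambda>t. \<omega> t e) \<longlongrightarrow> \<omega>L e) (at_left b)"
    "degenerate_edges (Es i) \<omega>L \<noteq> {}" using flow_from_surgery[OF flow i(1)] unfolding b_def by metis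
  \<comment> \<open>The second flow is continuous up to \<open>b\<close> and agrees with the first
    one before \<open>b\<close>, so its value at \<open>b\<close> is the left limit of the
    first.\<close>
  have "\<omega>' b e = \<omega>L e" if e: "e \<in> Es i" for e
  proof (rule tendsto_unique)
    show "((\<lambda>t. \<omega> t e) \<longlongrightarrow> \<omega>L e) (at_left b)" using \<omega>L(1)[OF e] .
    have "\<exists>D. ((\<lambda>s. \<omega>' s e) has_real_derivative D) (at t within phase k' T' i)" if "t \<in> phase k' T' i" for t
      using flow' i e T that unfolding flow_from_def solves_flow_on_def by metis
    then have "continuous_on (phase k' T' i) (\<lambda>s. \<omega>' s e)"
      using DERIV_continuous by (metis continuous_on_eq_continuous_within)
    then have "continuous_on {T i..b} (\<lambda>s. \<omega>' s e)"
      using phase_interval[OF b] T by (auto intro: continuous_on_subset)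
    then have "((\<lambda>s. \<omega>' s e) \<longlongrightarrow> \<omega>' b e) (at_left b)" using T(3) by (rule continuous_on_Icc_at_leftD)
    moreover have "\<forall>\<^sub>F t in at_left b. \<omega>' t e = \<omega> t e"
      using eventually_at_left_real[OF T(3)]
    proof eventually_elim
      case (elim t)
      then have "t \<in> phase k T i" using i by (simp add: phase_def b_def)
      moreover have "t \<in> phase k' T' i" using elim phase_interval[OF b] T by auto
      ultimately show ?case
        using flow_from_agree_phase[OF graph flow flow' _ _ agree _ _ e] i by simp
    qed
    ultimately show "((\<lambda>t. \<omega> t e) \<longlongrightarrow> \<omega>' b e) (at_left b)" by (rule Lim_transform_eventually)
  qed simp
  then have "degenerate_edges (Es i) (\<omega>' b) = degenerate_edges (Es i) \<omega>L" by (rule degenerate_edges_cong)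
  moreover have "degenerate_edges (Es' i) (\<omega>' b) = {}" using flow' i b by (simp add: flow_from_def)
  ultimately show False using \<omega>L(2) T(2) by simp
qed

text \<open>Comparing the two flows in both directions gives the same surgery time. The left limits
  there agree, and they determine both the deleted edges and the new initial values.\<close>

lemma flow_from_agree_Suc:
  assumes graph: "weighted_graph V E0 m1 m2"
    and flow: "flow_from V m1 m2 T0 E0 \<omega>0 k T Es \<omega>"
    and flow': "flow_from V m1 m2 T0' E0 \<omega>0' k' T' Es' \<omega>'"
    and i: "i < k" "i < k'" and agree: "agree_at_phase T Es \<omega> T' Es' \<omega>' i"
  shows "agree_at_phase T Es \<omega> T' Es' \<omega>' (Suc i)"
proof -
  define b where "b = T (Suc i)"
  have T: "T' i = T i" "Es' i = Es i" "T i < b"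
    using agree i flow by (auto simp: agree_at_phase_def flow_from_def b_def)
  have b: "T' (Suc i) = b"
    using flow_from_next_time_le[OF graph flow flow' _ _ agree]
      flow_from_next_time_le[OF graph flow' flow _ _ agree_at_phase_sym[OF agree]] i
    by (simp add: b_def)
  obtain \<omega>L where \<omega>L: "\<And>e. e \<in> Es i \<Longrightarrow> ((\<lambda>t. \<omega> t e) \<longlongrightarrow> \<omega>L e) (at_left b)"
    "Es (Suc i) = Es i - degenerate_edges (Es i) \<omega>L" "\<And>e. e \<in> Es (Suc i) \<Longrightarrow> \<omega> b e = \<omega>L e"
    using flow_from_surgery[OF flow i(1)] unfolding b_def by metis
  obtain \<omega>L' where \<omega>L': "\<And>e. e \<in> Es' i \<Longrightarrow> ((\<lambda>t. \<omega>' t e) \<longlongrightarrow> \<omega>L' e) (at_left b)"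
    "Es' (Suc i) = Es' i - degenerate_edges (Es' i) \<omega>L'" "\<And>e. e \<in> Es' (Suc i) \<Longrightarrow> \<omega>' b e = \<omega>L' e"
    using flow_from_surgery[OF flow' i(2)] unfolding b by metis
  have eq: "\<omega>L e = \<omega>L' e" if e: "e \<in> Es i" for e
  proof (rule tendsto_unique)
    show "((\<lambda>t. \<omega>' t e) \<longlongrightarrow> \<omega>L' e) (at_left b)" using \<omega>L'(1) e T by simp
    have "\<forall>\<^sub>F t in at_left b. \<omega> t e = \<omega>' t e"
      using eventually_at_left_real[OF T(3)]
    proof eventually_elim
      case (elim t)
      then have "t \<in> phase k T i" "t \<in> phase k' T' i" using i b T by (simp_all add: phase_def b_def)
      then show ?case
        using flow_from_agree_phase[OF graph flow flow' _ _ agree _ _ e] i by simp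
    qed
    with \<omega>L(1)[OF e] show "((\<lambda>t. \<omega>' t e) \<longlongrightarrow> \<omega>L e) (at_left b)" by (rule Lim_transform_eventually)
  qed simp
  then have "degenerate_edges (Es i) \<omega>L = degenerate_edges (Es i) \<omega>L'" by (rule degenerate_edges_cong)
  then have Es: "Es' (Suc i) = Es (Suc i)" using \<omega>L(2) \<omega>L'(2) T(2) by simp
  moreover have "\<omega> b e = \<omega>' b e" if "e \<in> Es (Suc i)" for e
    using that \<omega>L(2,3) \<omega>L'(3) Es eq by auto
  ultimately show ?thesis using b by (simp add: agree_at_phase_def b_def)
qed

lemma flow_from_unique:
  assumes graph: "weighted_graph V E0 m1 m2"
    and flow: "flow_from V m1 m2 T0 E0 \<omega>0 k T Es \<omega>"
    and flow': "flow_from V m1 m2 T0 E0 \<omega>0 k' T' Es' \<omega>'"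
  shows "same_solution k T Es \<omega> k' T' Es' \<omega>'"
proof -
  have agree: "agree_at_phase T Es \<omega> T' Es' \<omega>' i" if "i \<le> k" "i \<le> k'" for i
    using that
  proof (induction i)
    case 0
    then show ?case using flow flow' by (simp add: flow_from_def agree_at_phase_def)
  next
    case (Suc i)
    then show ?case by (intro flow_from_agree_Suc[OF graph flow flow']) auto
  qed
  \<comment> \<open>If one flow had fewer phases, its last phase would be unbounded while the other
    flow has a surgery in the phase of the same index, contradicting
    \<open>flow_from_next_time_le\<close>.\<close>
  have k: "k = k'"
  proof (rule ccontr)
    assume "k \<noteq> k'"
    then consider "k < k'" | "k' < k" by linarith
    then show False
    proof cases
      case 1
      then show False
        using flow_from_next_time_le[OF graph flow' flow _ _ agree_at_phase_sym[OF agree], of k] by simp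
    next
      case 2
      then show False
        using flow_from_next_time_le[OF graph flow flow' _ _ agree, of k'] by simp
    qed
  qed
  have "\<omega> t e = \<omega>' t e" if i: "i \<le> k" and t: "t \<in> phase k T i" and e: "e \<in> Es i" for i t e
  proof -
    \<comment> \<open>Phase \<open>i\<close> is unbounded for both flows or ends at the common start
      of phase \<open>Suc i\<close>.\<close>
    have "phase k' T' i = phase k T i"
      using agree[of i] agree[of "Suc i"] i k by (auto simp: phase_def agree_at_phase_def)
    then show ?thesis
      using flow_from_agree_phase[OF graph flow flow' i _ agree _ _ e] i t k by simp
  qed
  then show ?thesis using agree k by (simp add: same_solution_def agree_at_phase_def)
qed

theorem theorem1p1:
  fixes V :: "'a set" and E :: "'a set set"
    and m1 :: "'a \<Rightarrow> real" and m2 \<omega>0 :: "'a set \<Rightarrow> real"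
  assumes "finite V" and "simple_graph V E" and "connected_graph V E"
    and "\<forall>x\<in>V. 0 < m1 x" and "\<forall>e\<in>E. 0 < m2 e" and "\<forall>e\<in>E. 0 < \<omega>0 e"
  shows "(\<exists>k T Es \<omega>. flow_solution V E m1 m2 \<omega>0 k T Es \<omega>) \<and>
    (\<forall>k T Es \<omega> k' T' Es' \<omega>'.
       flow_solution V E m1 m2 \<omega>0 k T Es \<omega> \<longrightarrow>
       flow_solution V E m1 m2 \<omega>0 k' T' Es' \<omega>' \<longrightarrow>
       same_solution k T Es \<omega> k' T' Es' \<omega>')"
proof -
  have "weighted_graph V E m1 m2" using assms by unfold_locales auto
  then have graph: "weighted_graph V (E - degenerate_edges E \<omega>0) m1 m2"
    by (rule weighted_graph.subgraph) auto
  have pos: "\<forall>e\<in>E - degenerate_edges E \<omega>0. 0 < \<omega>0 e" using assms(6) by blast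
  show ?thesis
    unfolding flow_solution_iff
    using flow_from_exists[OF graph pos degenerate_edges_diff] flow_from_unique[OF graph] by blast
qed

end
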